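(* Let $\mathcal D$ be the mirror Heisenberg–Virasoro algebra, with basis $\{d_m,h_r,\mathbf c,\mathbf l: m\in\mathbb Z, r\in\frac12+\mathbb Z\}$ and brackets $[d_m,d_n]=(m-n)d_{m+n}+\frac{m^3-m}{12}\delta_{m+n,0}\mathbf c$, $[d_m,h_r]=-rh_{m+r}$, $[h_r,h_s]=r\delta_{r+s,0}\mathbf l$, $[\mathbf c,\mathcal D]=[\mathbf l,\mathcal D]=0$. Let $\mathcal H=\mathrm{Span}\{h_r,\mathbf l: r\in\frac12+\mathbb Z\}$ and $\mathfrak p=\mathbb C\mathbf c\oplus\mathcal H$. Let $\phi:\mathfrak p\to\mathbb C$ be a Lie algebra homomorphism with $\phi(\mathcal H)\neq 0$. Then $W(\phi)$ is irreducible if and only if $\phi$ is not an exp-polynomial function.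
   Context: A Lie algebra homomorphism $\phi:\mathfrak p\to\mathbb C$ is a linear map vanishing on $[\mathfrak p,\mathfrak p]=\mathbb C\mathbf l$. $W(\phi)=\mathcal U(\mathcal D)\otimes_{\mathcal U(\mathfrak p)}\mathbb C w_\phi$, where $\mathbb C w_\phi$ is the one-dimensional $\mathfrak p$-module with $pw_\phi=\phi(p)w_\phi$. $\phi$ is called an exp-polynomial function if there exist distinct nonzero complex numbers $a_1,\dots,a_\ell$ and polynomials $f_1,\dots,f_\ell\in\mathbb C[t]$ such that $\phi(h_{\frac12+n})=a_1^nf_1(n)+\dots+a_\ell^nf_\ell(n)$ for all $n\in\mathbb Z$. *)

theory Defs
  imports Complex_Main "HOL-Library.Poly_Mapping" "HOL-Computational_Algebra.Polynomial"
begin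

text \<open>Basis of the mirror Heisenberg-Virasoro algebra:
  D m = d_m, H n = h_(1/2 + n), C = central c, L = central l.\<close>
datatype gen = D int | H int | C | L

text \<open>Tensor algebra T(D) on the basis: finitely supported functions on words.\<close>
type_synonym tens = "gen list \<Rightarrow>\<^sub>0 complex"

definition tmul :: "tens \<Rightarrow> tens \<Rightarrow> tens" where
  "tmul a b = (\<Sum>u\<in>Poly_Mapping.keys a. \<Sum>v\<in>Poly_Mapping.keys b. Poly_Mapping.single (u @ v) (Poly_Mapping.lookup a u * Poly_Mapping.lookup b v))"

definition gvec :: "gen \<Rightarrow> tens" where
  "gvec x = Poly_Mapping.single [x] 1"

definition tscal :: "complex \<Rightarrow> tens" where
  "tscal c = Poly_Mapping.single [] c"

fun br :: "gen \<Rightarrow> gen \<Rightarrow> tens" where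
  "br (D m) (D n) = Poly_Mapping.single [D (m + n)] (of_int (m - n))
      + (if m + n = 0 then Poly_Mapping.single [C] (of_int (m ^ 3 - m) / 12) else 0)"
| "br (D m) (H n) = Poly_Mapping.single [H (m + n)] (- (of_int n + 1/2))"
| "br (H n) (D m) = Poly_Mapping.single [H (m + n)] (of_int n + 1/2)"
| "br (H n) (H k) = (if n + k = -1 then Poly_Mapping.single [L] (of_int n + 1/2) else 0)"
| "br _ _ = 0"

definition left_ideal :: "tens set \<Rightarrow> bool" where
  "left_ideal S \<longleftrightarrow> 0 \<in> S \<and> (\<forall>x\<in>S. \<forall>y\<in>S. x + y \<in> S) \<and> (\<forall>a. \<forall>x\<in>S. tmul a x \<in> S)"

definition in_p :: "gen \<Rightarrow> bool" where
  "in_p x = (case x of D _ \<Rightarrow> False | _ \<Rightarrow> True)"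

text \<open>Generators of the left ideal K with T(D)/K = U(D) \<otimes>_{U(p)} C w_phi:
  the two-sided ideal defining U(D), and p - phi(p) for p in p.
  A linear map phi on p is given by its values on the basis elements H n, C, L.\<close>
definition Wgens :: "(gen \<Rightarrow> complex) \<Rightarrow> tens set" where
  "Wgens \<phi> =
     {tmul (tmul a (tmul (gvec x) (gvec y) - tmul (gvec y) (gvec x) - br x y)) b | a b x y. True}
     \<union> {gvec p - tscal (\<phi> p) | p. in_p p}"

definition Wker :: "(gen \<Rightarrow> complex) \<Rightarrow> tens set" where
  "Wker \<phi> = \<Inter>{S. left_ideal S \<and> Wgens \<phi> \<subseteq> S}"

text \<open>W(phi) = T(D)/Wker phi is irreducible: nonzero, and its only D-submodules
  (= left ideals of T(D) containing Wker phi) are trivial.\<close>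
definition W_irreducible :: "(gen \<Rightarrow> complex) \<Rightarrow> bool" where
  "W_irreducible \<phi> \<longleftrightarrow> Wker \<phi> \<noteq> UNIV \<and>
     (\<forall>S. left_ideal S \<and> Wker \<phi> \<subseteq> S \<longrightarrow> S = Wker \<phi> \<or> S = UNIV)"

definition exp_polynomial :: "(gen \<Rightarrow> complex) \<Rightarrow> bool" where
  "exp_polynomial \<phi> \<longleftrightarrow> (\<exists>A (f :: complex \<Rightarrow> complex poly). finite A \<and> 0 \<notin> A \<and>
     (\<forall>n::int. \<phi> (H n) = (\<Sum>a\<in>A. a powi n * poly (f a) (of_int n))))"

end

theory Submission
  imports Defs "HOL-Computational_Algebra.Fundamental_Theorem_Algebra" "HOL-Library.Product_Lexorder"
begin

text \<open>
  The sequence \<open>\<phi> (H n)\<close> is exp-polynomial iff it satisfies a linear recurrence, that is, iff some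
  \<open>v = \<Sum>c\<^sub>m d\<^sub>m \<noteq> 0\<close> has \<open>\<Sum>c\<^sub>m \<phi> (H (m + n)) = 0\<close> for all \<open>n\<close>; and since \<open>[h\<^sub>r, v] = r \<Sum>c\<^sub>m h\<^bsub>m+r\<^esub>\<close>,
  the latter means that \<open>\<phi>\<close> extends to a character of the subalgebra \<open>\<complex>v + \<pp>\<close>, with an arbitrary
  value on \<open>v\<close>.

  If there is such a \<open>v\<close>, the modules induced from the characters with \<open>v \<mapsto> 0\<close> and \<open>v \<mapsto> 1\<close> are
  nonzero quotients of \<open>W(\<phi>)\<close> with different kernels, so \<open>W(\<phi>)\<close> is reducible. That an induced module is
  nonzero is the Poincare-Birkhoff-Witt theorem; it is proved here by defining the coefficient of the
  empty word in the normal form of a word, through confluent rewriting.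

  If there is none, filter \<open>W(\<phi>)\<close> by the number of letters \<open>d\<^sub>m\<close>. The operators \<open>h\<^sub>r - \<phi>(h\<^sub>r)\<close> lower the
  degree and act on symbols as the derivations \<open>d\<^sub>m \<mapsto> r \<phi>(h\<^bsub>m+r\<^esub>)\<close>. On finitely many letters these span
  all derivations with constant coefficients, hence Euler's operator \<open>\<Sum>d\<^sub>m \<partial>\<^sub>m\<close> is available inside any
  submodule, and a nonzero submodule contains an element of degree 0.
\<close>

section \<open>Exponential polynomials and linear recurrences\<close>

text \<open>The polynomial \<open>p\<close> evaluated at the shift operator, which sends
  \<open>s\<close> to \<open>\<lambda>n. s (n + 1)\<close>. Folding over the coefficients gives a
  recursion along \<open>pCons\<close>, which suits induction on polynomials.\<close>

definition act :: "complex poly \<Rightarrow> (int \<Rightarrow> complex) \<Rightarrow> int \<Rightarrow> complex" where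
  "act p s = fold_coeffs (\<lambda>a f n. a * s n + f (n + 1)) p (\<lambda>n. 0)"

lemma act_0 [simp]: "act 0 s = (\<lambda>n. 0)"
  by (simp add: act_def)

lemma act_pCons [simp]: "act (pCons a p) s n = a * s n + act p s (n + 1)"
  by (cases "p = 0 \<and> a = 0") (auto simp: act_def)

lemma act_zero_seq [simp]: "act p (\<lambda>n. 0) n = 0"
  by (induction p arbitrary: n) auto

lemma act_add: "act (p + q) s n = act p s n + act q s n"
proof (induction p arbitrary: q n)
  case 0
  then show ?case by simp
next
  case (pCons a p)
  obtain b r where q: "q = pCons b r" by (cases q)
  show ?case using pCons.IH[of r "n + 1"] by (simp add: q algebra_simps)
qed

lemma act_smult: "act (smult c p) s n = c * act p s n"
  by (induction p arbitrary: n) (auto simp: algebra_simps)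

lemma act_sum: "act (sum p A) s n = (\<Sum>i\<in>A. act (p i) s n)"
  by (induction A rule: infinite_finite_induct) (auto simp: act_add)

lemma act_monom: "act (monom c k) s n = c * s (n + int k)"
  by (induction k arbitrary: n) (auto simp: monom_0 monom_Suc algebra_simps)

lemma act_seq_add: "act p (\<lambda>n. s n + t n) n = act p s n + act p t n"
  by (induction p arbitrary: n) (auto simp: algebra_simps)

lemma act_seq_scale: "act p (\<lambda>n. c * s n) n = c * act p s n"
  by (induction p arbitrary: n) (auto simp: algebra_simps)

lemma act_shift: "act p (\<lambda>n. s (n + 1)) n = act p s (n + 1)"
  by (induction p arbitrary: n) (auto simp: algebra_simps)

text \<open>Sequences thereby form a module over the polynomial ring, so annihilating polynomials
  can be multiplied in either order.\<close>

lemma act_mult: "act (p * q) s n = act p (act q s) n"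
  by (induction p arbitrary: n) (auto simp: act_add act_smult)

lemma act_conv_sum: "act p s n = (\<Sum>i\<le>degree p. coeff p i * s (n + int i))"
proof -
  have "act p s n = act (\<Sum>i\<le>degree p. monom (coeff p i) i) s n"
    by (simp add: poly_as_sum_of_monoms)
  also have "\<dots> = (\<Sum>i\<le>degree p. coeff p i * s (n + int i))"
    by (simp add: act_sum act_monom)
  finally show ?thesis .
qed

text \<open>The shift operator satisfies a Leibniz rule for multiplication by \<open>n\<close>;
  hence the square of an annihilating polynomial of \<open>s n\<close> annihilates \<open>n * s n\<close>.\<close>
lemma act_times_index:
  "act p (\<lambda>n. of_int n * s n) n = of_int n * act p s n + act (pCons 0 (pderiv p)) s n"
proof (induction p arbitrary: n)
  case 0
  then show ?case by simp
next
  case (pCons a p)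
  then show ?case
    by (simp add: pderiv_pCons act_add algebra_simps)
qed

definition recurrent :: "(int \<Rightarrow> complex) \<Rightarrow> bool" where
  "recurrent s \<longleftrightarrow> (\<exists>p. p \<noteq> 0 \<and> (\<forall>n. act p s n = 0))"

lemma recurrent_zero: "recurrent (\<lambda>n. 0)"
  unfolding recurrent_def by (rule exI[of _ 1]) simp

lemma recurrent_add:
  assumes "recurrent s" "recurrent t" shows "recurrent (\<lambda>n. s n + t n)"
proof -
  obtain p q where p: "p \<noteq> 0" "\<And>n. act p s n = 0" and q: "q \<noteq> 0" "\<And>n. act q t n = 0"
    using assms unfolding recurrent_def by blast
  have ps: "act p s = (\<lambda>n. 0)" and qt: "act q t = (\<lambda>n. 0)" using p q by auto
  \<comment> \<open>The product kills both summands because its factors commute.\<close>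
  have "act (p * q) (\<lambda>n. s n + t n) n = act (q * p) s n + act (p * q) t n" for n
    by (simp add: act_seq_add mult.commute)
  then have "act (p * q) (\<lambda>n. s n + t n) n = 0" for n
    by (simp add: act_mult ps qt)
  then show ?thesis unfolding recurrent_def using p(1) q(1) by (intro exI[of _ "p * q"]) simp
qed

lemma recurrent_scale:
  assumes "recurrent s" shows "recurrent (\<lambda>n. c * s n)"
  using assms unfolding recurrent_def by (auto simp: act_seq_scale)

lemma recurrent_times_index:
  assumes "recurrent s" shows "recurrent (\<lambda>n. of_int n * s n)"
proof -
  obtain p where p: "p \<noteq> 0" "\<And>n. act p s n = 0"
    using assms unfolding recurrent_def by blast
  have ps: "act p s = (\<lambda>n. 0)" using p by auto
  \<comment> \<open>The derivative of \<open>p * p\<close> keeps a factor \<open>p\<close>, so both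
    terms of the Leibniz rule vanish.\<close>
  have e: "pCons 0 (pderiv (p * p)) = (pCons 0 (pderiv p) + pCons 0 (pderiv p)) * p"
    by (simp add: pderiv_mult algebra_simps)
  have "act (p * p) (\<lambda>n. of_int n * s n) n = 0" for n
    by (simp only: act_times_index e act_mult ps) simp
  then show ?thesis unfolding recurrent_def using p(1) by (intro exI[of _ "p * p"]) simp
qed

lemma recurrent_power: "a \<noteq> 0 \<Longrightarrow> recurrent (\<lambda>n. a powi n)"
  unfolding recurrent_def
  by (intro exI[of _ "[:-a, 1:]"]) (simp add: power_int_add)

lemma recurrent_power_poly:
  assumes "a \<noteq> 0" shows "recurrent (\<lambda>n. a powi n * poly f (of_int n))"
proof (induction f)
  case 0
  then show ?case by (simp add: recurrent_zero)
next
  case (pCons c f)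
  from recurrent_add[OF recurrent_scale[OF recurrent_power[OF assms], of c] recurrent_times_index[OF pCons.IH]]
  show ?case by (simp add: algebra_simps)
qed

definition exp_poly :: "(int \<Rightarrow> complex) \<Rightarrow> bool" where
  "exp_poly s \<longleftrightarrow> (\<exists>A (f :: complex \<Rightarrow> complex poly). finite A \<and> 0 \<notin> A \<and>
     (\<forall>n. s n = (\<Sum>a\<in>A. a powi n * poly (f a) (of_int n))))"

lemma exp_poly_imp_recurrent:
  assumes "exp_poly s" shows "recurrent s"
proof -
  obtain A and f :: "complex \<Rightarrow> complex poly" where A: "finite A" "0 \<notin> A"
    and s: "\<And>n. s n = (\<Sum>a\<in>A. a powi n * poly (f a) (of_int n))"
    using assms unfolding exp_poly_def by blast
  have "recurrent (\<lambda>n. \<Sum>a\<in>A. a powi n * poly (f a) (of_int n))"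
    using A
  proof (induction A rule: finite_induct)
    case empty
    then show ?case by (simp add: recurrent_zero)
  next
    case (insert a A)
    then have "recurrent (\<lambda>n. a powi n * poly (f a) (of_int n)
        + (\<Sum>a\<in>A. a powi n * poly (f a) (of_int n)))"
      by (intro recurrent_add recurrent_power_poly) auto
    with insert.hyps show ?case by simp
  qed
  moreover have "s = (\<lambda>n. \<Sum>a\<in>A. a powi n * poly (f a) (of_int n))" using s by blast
  ultimately show ?thesis by simp
qed

lemma exp_poly_zero: "exp_poly (\<lambda>n. 0)"
  unfolding exp_poly_def by (rule exI[of _ "{}"]) simp

lemma exp_poly_power_poly: "a \<noteq> 0 \<Longrightarrow> exp_poly (\<lambda>n. a powi n * poly f (of_int n))"
  unfolding exp_poly_def by (intro exI[of _ "{a}"] exI[of _ "\<lambda>_. f"]) simp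

lemma exp_poly_scale:
  assumes "exp_poly s" shows "exp_poly (\<lambda>n. c * s n)"
proof -
  obtain A and f :: "complex \<Rightarrow> complex poly" where A: "finite A" "0 \<notin> A"
    and s: "\<And>n. s n = (\<Sum>a\<in>A. a powi n * poly (f a) (of_int n))"
    using assms unfolding exp_poly_def by blast
  show ?thesis unfolding exp_poly_def
    using A by (intro exI[of _ A] exI[of _ "\<lambda>a. smult c (f a)"])
      (auto simp: s sum_distrib_left algebra_simps)
qed

lemma exp_poly_add:
  assumes "exp_poly s" "exp_poly t" shows "exp_poly (\<lambda>n. s n + t n)"
proof -
  obtain A and f :: "complex \<Rightarrow> complex poly" where A: "finite A" "0 \<notin> A"
    and s: "\<And>n. s n = (\<Sum>a\<in>A. a powi n * poly (f a) (of_int n))"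
    using assms(1) unfolding exp_poly_def by blast
  obtain B and g :: "complex \<Rightarrow> complex poly" where B: "finite B" "0 \<notin> B"
    and t: "\<And>n. t n = (\<Sum>a\<in>B. a powi n * poly (g a) (of_int n))"
    using assms(2) unfolding exp_poly_def by blast
  \<comment> \<open>Padding with zero polynomials puts both sums on the common set of bases
    \<open>A \<union> B\<close>.\<close>
  define h where "h = (\<lambda>a. (if a \<in> A then f a else 0) + (if a \<in> B then g a else 0))"
  have "s n + t n = (\<Sum>a\<in>A \<union> B. a powi n * poly (h a) (of_int n))" for n
  proof -
    have "s n = (\<Sum>a\<in>A \<union> B. a powi n * poly (if a \<in> A then f a else 0) (of_int n))"
      unfolding s using A B by (intro sum.mono_neutral_cong_left) auto
    moreover have "t n = (\<Sum>a\<in>A \<union> B. a powi n * poly (if a \<in> B then g a else 0) (of_int n))"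
      unfolding t using A B by (intro sum.mono_neutral_cong_left) auto
    ultimately show ?thesis by (simp add: h_def sum.distrib distrib_left)
  qed
  then show ?thesis unfolding exp_poly_def using A B by (intro exI[of _ "A \<union> B"] exI[of _ h]) auto
qed

section \<open>Falling factorials and first-order difference equations\<close>

definition falling :: "nat \<Rightarrow> complex poly" where
  "falling k = (\<Prod>i<k. [:- of_nat i, 1:])"

lemma falling_0 [simp]: "falling 0 = 1"
  by (simp add: falling_def)

lemma poly_falling_Suc: "poly (falling (Suc k)) x = poly (falling k) x * (x - of_nat k)"
  by (simp add: falling_def algebra_simps)

lemma poly_falling_shift: "poly (falling (Suc k)) (x + 1) = (x + 1) * poly (falling k) x"
proof (induction k)
  case 0
  then show ?case by (simp add: poly_falling_Suc)
next
  case (Suc k)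
  show ?case
    unfolding poly_falling_Suc[of "Suc k" "x + 1"] Suc.IH poly_falling_Suc[of k x] by simp
qed

text \<open>Falling factorials are to differences what powers are to derivatives, hence the right
  basis for solving difference equations.\<close>

lemma falling_difference:
  "poly (falling (Suc k)) (x + 1) - poly (falling (Suc k)) x = of_nat (Suc k) * poly (falling k) x"
  unfolding poly_falling_shift poly_falling_Suc[of k x] by (simp add: algebra_simps)

text \<open>Falling factorials span all polynomials: their span \<open>Q\<close> contains 1 and is
  closed under multiplication by the variable, which maps \<open>falling k\<close> to
  \<open>falling (Suc k)\<close> plus \<open>k\<close> times \<open>falling k\<close>.\<close>

lemma falling_combination_induct:
  assumes zero: "P 0" and add: "\<And>f g. P f \<Longrightarrow> P g \<Longrightarrow> P (f + g)"
    and scale: "\<And>c k. P (smult c (falling k))"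
  shows "P f"
proof -
  define Q where "Q f \<longleftrightarrow> (\<exists>K c. f = (\<Sum>k<(K::nat). smult (c k) (falling k)))" for f
  have Qadd: "Q (f + g)" if fg: "Q f" "Q g" for f g
  proof -
    obtain K c where f: "f = (\<Sum>k<K. smult (c k) (falling k))" using fg(1) unfolding Q_def by blast
    obtain J d where g: "g = (\<Sum>k<J. smult (d k) (falling k))" using fg(2) unfolding Q_def by blast
    define N where "N = max K J"
    have "f = (\<Sum>k<N. smult (if k < K then c k else 0) (falling k))"
      unfolding f N_def by (intro sum.mono_neutral_cong_left) auto
    moreover have "g = (\<Sum>k<N. smult (if k < J then d k else 0) (falling k))"
      unfolding g N_def by (intro sum.mono_neutral_cong_left) auto
    ultimately have "f + g = (\<Sum>k<N. smult ((if k < K then c k else 0) + (if k < J then d k else 0)) (falling k))"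
      by (simp only: sum.distrib smult_add_left)
    then show ?thesis unfolding Q_def
      by (intro exI[of _ N] exI[of _ "\<lambda>k. (if k < K then c k else 0) + (if k < J then d k else 0)"])
  qed
  have Qone: "Q (smult c (falling k))" for c k
    unfolding Q_def
    by (intro exI[of _ "Suc k"] exI[of _ "\<lambda>i. if i = k then c else 0"])
      (simp add: if_distrib[of "\<lambda>c. smult c _"] sum.delta cong: if_cong)
  have Qsum: "Q (sum h I)" if "\<And>i. i \<in> I \<Longrightarrow> Q (h i)" for h :: "nat \<Rightarrow> _" and I
    using that
  proof (induction I rule: infinite_finite_induct)
    case (insert x F)
    then show ?case by (simp add: Qadd)
  qed (use Qone[of 0 0] in auto)
  have QX: "Q (pCons 0 f)" if Qf: "Q f" for f
  proof -
    obtain K c where f: "f = (\<Sum>k<K. smult (c k) (falling k))" using Qf unfolding Q_def by blast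
    have "pCons 0 (falling k) = falling (Suc k) + smult (of_nat k) (falling k)" for k
      by (simp add: falling_def)
    then have X: "[:0, 1:] * falling k = falling (Suc k) + smult (of_nat k) (falling k)" for k by simp
    have "pCons 0 f = [:0, 1:] * f" by simp
    also have "\<dots> = (\<Sum>k<K. smult (c k) (falling (Suc k)) + smult (c k * of_nat k) (falling k))"
      unfolding f sum_distrib_left
      by (intro sum.cong refl) (simp only: mult_smult_right X smult_add_right smult_smult)
    finally show ?thesis by (simp only:) (intro Qsum Qadd Qone)
  qed
  have "Q f"
  proof (induction f)
    case 0
    then show ?case using Qone[of 0 0] by simp
  next
    case (pCons a p)
    have "pCons a p = smult a (falling 0) + pCons 0 p" by simp
    then show ?case using Qadd[OF Qone QX[OF pCons.IH], of a 0] by simp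
  qed
  then obtain K c where f: "f = (\<Sum>k<K. smult (c k) (falling k))" unfolding Q_def by blast
  have "P (\<Sum>k<K. smult (c k) (falling k))" for K
    by (induction K) (auto intro: zero add scale)
  then show ?thesis using f by simp
qed

lemma exp_poly_solve_power_poly:
  assumes a: "a \<noteq> 0" and b: "b \<noteq> 0"
  shows "\<exists>g. exp_poly g \<and> (\<forall>n. g (n + 1) - a * g n = b powi n * poly f (of_int n))"
proof (induction f rule: falling_combination_induct)
  case 1
  show ?case by (rule exI[of _ "\<lambda>n. 0"]) (simp add: exp_poly_zero)
next
  case (2 f h)
  then obtain g1 g2 where "exp_poly g1" "exp_poly g2"
    "\<And>n. g1 (n + 1) - a * g1 n = b powi n * poly f (of_int n)"
    "\<And>n. g2 (n + 1) - a * g2 n = b powi n * poly h (of_int n)" by blast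
  then show ?case
    by (intro exI[of _ "\<lambda>n. g1 n + g2 n"]) (simp add: exp_poly_add algebra_simps)
next
  case (3 c k)
  have "\<exists>g. exp_poly g \<and> (\<forall>n. g (n + 1) - a * g n = b powi n * poly (falling k) (of_int n))"
  proof (cases "a = b")
    case True
    \<comment> \<open>Resonance raises the degree by one: the operator sends
      \<open>b powi n * falling (Suc k)\<close> to \<open>b * Suc k\<close> times the required
      right-hand side, and the witness divides by this constant.\<close>
    have "poly (falling (Suc k)) (of_int n + 1) = poly (falling (Suc k)) (of_int n)
        + of_nat (Suc k) * poly (falling k) (of_int n)" for n
      using falling_difference[of k "of_int n"] by (simp add: algebra_simps)
    then show ?thesis using exp_poly_scale[OF exp_poly_power_poly[OF b, of "falling (Suc k)"], of "1 / (b * of_nat (Suc k))"] b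
      unfolding True
      by (intro exI[of _ "\<lambda>n. 1 / (b * of_nat (Suc k)) * (b powi n * poly (falling (Suc k)) (of_int n))"])
        (simp add: power_int_add field_simps del: of_nat_Suc)
  next
    case False
    define c' where "c' = 1 / (b - a)"
    have c': "c' * (b - a) = 1" using False by (simp add: c'_def)
    show ?thesis
    proof (induction k)
      case 0
      have "exp_poly (\<lambda>n. c' * (b powi n * poly 1 (of_int n)))"
        by (intro exp_poly_scale exp_poly_power_poly b)
      moreover have "\<And>q. c' * (b * q) - a * (c' * q) = q"
        using c' by algebra
      ultimately show ?case using b
        by (intro exI[of _ "\<lambda>n. c' * (b powi n * poly 1 (of_int n))"])
          (simp add: power_int_add mult.commute[of _ b])
    next
      case (Suc k)
      then obtain g where g: "exp_poly g"
        "\<And>n. g (n + 1) - a * g n = b powi n * poly (falling k) (of_int n)" by blast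
      have g': "g (n + 1) = a * g n + b powi n * poly (falling k) (of_int n)" for n
        using g(2)[of n] by (simp add: algebra_simps)
      \<comment> \<open>Applying the operator to the right-hand side \<open>q\<close> itself gives
        \<open>(b - a) * q\<close> plus a multiple of the case \<open>k\<close>; the latter is
        cancelled by \<open>g\<close>, and \<open>c'\<close> normalises the rest.\<close>
      define q where "q n = b powi n * poly (falling (Suc k)) (of_int n)" for n
      have q: "q (n + 1) = b * q n + b * of_nat (Suc k) * (b powi n * poly (falling k) (of_int n))" for n
      proof -
        have "poly (falling (Suc k)) (of_int n + 1) = poly (falling (Suc k)) (of_int n)
            + of_nat (Suc k) * poly (falling k) (of_int n)"
          using falling_difference[of k "of_int n"] by (simp add: algebra_simps)
        then show ?thesis using b by (simp add: q_def power_int_add algebra_simps del: of_nat_Suc)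
      qed
      have "exp_poly (\<lambda>n. c' * (q n + (- b * of_nat (Suc k)) * g n))"
        unfolding q_def by (intro exp_poly_scale exp_poly_add exp_poly_power_poly b g)
      moreover have "c' * (q (n + 1) + (- b * of_nat (Suc k)) * g (n + 1))
          - a * (c' * (q n + (- b * of_nat (Suc k)) * g n)) = q n" for n
        unfolding q g' using c' by algebra
      ultimately show ?case unfolding q_def by blast
    qed
  qed
  then obtain g where "exp_poly g" "\<And>n. g (n + 1) - a * g n = b powi n * poly (falling k) (of_int n)"
    by blast
  then show ?case
    by (intro exI[of _ "\<lambda>n. c * g n"])
      (simp add: exp_poly_scale mult.left_commute[of _ c] flip: right_diff_distrib)
qed

text \<open>Solves for one linear factor of a recurrence inside the exponential polynomials; by
  linearity each base can be treated separately.\<close>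

lemma exp_poly_solve:
  assumes a: "a \<noteq> 0" and s: "exp_poly s"
  shows "\<exists>g. exp_poly g \<and> (\<forall>n. g (n + 1) - a * g n = s n)"
proof -
  obtain A and f :: "complex \<Rightarrow> complex poly" where A: "finite A" "0 \<notin> A"
    and s: "\<And>n. s n = (\<Sum>a\<in>A. a powi n * poly (f a) (of_int n))"
    using s unfolding exp_poly_def by blast
  have "\<exists>g. exp_poly g \<and> (\<forall>n. g (n + 1) - a * g n = (\<Sum>a\<in>A. a powi n * poly (f a) (of_int n)))"
    using A
  proof (induction A rule: finite_induct)
    case empty
    show ?case by (rule exI[of _ "\<lambda>n. 0"]) (simp add: exp_poly_zero)
  next
    case (insert b B)
    then obtain g1 where g1: "exp_poly g1"
      "\<And>n. g1 (n + 1) - a * g1 n = (\<Sum>a\<in>B. a powi n * poly (f a) (of_int n))" by auto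
    obtain g2 where g2: "exp_poly g2" "\<And>n. g2 (n + 1) - a * g2 n = b powi n * poly (f b) (of_int n)"
      using exp_poly_solve_power_poly[OF a, of b "f b"] insert.prems by auto
    have "g2 (n + 1) + g1 (n + 1) - a * (g2 n + g1 n)
        = (\<Sum>a\<in>insert b B. a powi n * poly (f a) (of_int n))" for n
      using g1(2)[of n] g2(2)[of n] insert.hyps by (simp add: algebra_simps)
    then show ?case using exp_poly_add[OF g2(1) g1(1)] by blast
  qed
  then show ?thesis by (simp add: s)
qed

lemma geometric_int_sequence:
  fixes u :: "int \<Rightarrow> complex"
  assumes a: "a \<noteq> 0" and u: "\<And>n. u (n + 1) = a * u n"
  shows "u n = a powi n * u 0"
proof (induction n rule: int_induct[of _ 0])
  case base
  then show ?case by simp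
next
  case (step1 i)
  then show ?case using a by (simp add: u power_int_add)
next
  case (step2 i)
  then show ?case using a u[of "i - 1"] by (simp add: power_int_diff field_simps)
qed

text \<open>Induction on the degree. Splitting off a root \<open>a\<close> leaves a factor
  \<open>q\<close> that annihilates \<open>t n = s (n + 1) - a * s n\<close>, so \<open>t\<close> is
  exponential-polynomial. A particular solution \<open>g\<close> for \<open>t\<close> then differs
  from \<open>s\<close> by a geometric sequence.\<close>

lemma recurrent_imp_exp_poly:
  assumes "recurrent s" shows "exp_poly s"
proof -
  obtain p where "p \<noteq> 0" "\<And>n. act p s n = 0" using assms unfolding recurrent_def by blast
  then show ?thesis
  proof (induction "degree p" arbitrary: p s)
    case 0
    then obtain c where "p = [:c:]" by (metis degree_eq_zeroE)
    with 0 have "s = (\<lambda>n. 0)" by auto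
    then show ?case by (simp add: exp_poly_zero)
  next
    case (Suc d)
    have "\<not> constant (poly p)" using Suc.hyps(2) by (simp add: constant_degree)
    then obtain a where "poly p a = 0" using fundamental_theorem_of_algebra by blast
    then obtain q where p: "p = [:-a, 1:] * q" by (auto simp: poly_eq_0_iff_dvd elim: dvdE)
    have q0: "q \<noteq> 0" using p Suc.prems by auto
    have d: "d = degree q" using Suc.hyps(2) q0 unfolding p by (subst (asm) degree_mult_eq) auto
    define t where "t n = s (n + 1) - a * s n" for n
    have t': "t = (\<lambda>n. s (n + 1) + (- a) * s n)" by (auto simp: t_def)
    have "act p s n = act q t n" for n
      unfolding p t' act_seq_add act_seq_scale act_shift act_mult by simp
    then have qt: "act q t n = 0" for n using Suc.prems by simp
    show ?case
    proof (cases "a = 0")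
      case True
      \<comment> \<open>The shift is invertible on two-sided sequences, so a factor X of the
        recurrence can be cancelled.\<close>
      then have "act q s (n + 1) = 0" for n
        using qt[of n] unfolding t' act_seq_add act_seq_scale act_shift by simp
      then have "act q s n = 0" for n by (metis diff_add_cancel)
      then show ?thesis using Suc.hyps(1)[OF d q0] by blast
    next
      case False
      have "exp_poly t" using Suc.hyps(1)[OF d q0] qt by blast
      then obtain g where g: "exp_poly g" "\<And>n. g (n + 1) - a * g n = t n"
        using exp_poly_solve[OF False] by blast
      define u where "u n = s n + (-1) * g n" for n
      have "u (n + 1) = a * u n" for n using g(2)[of n] by (simp add: u_def t_def algebra_simps)
      then have u: "u n = a powi n * u 0" for n using geometric_int_sequence[OF False] by blast
      have "s = (\<lambda>n. a powi n * poly [:u 0:] (of_int n) + g n)"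
        using u by (auto simp: u_def fun_eq_iff algebra_simps)
      then show ?thesis using exp_poly_add[OF exp_poly_power_poly[OF False] g(1)] by metis
    qed
  qed
qed

section \<open>The tensor algebra\<close>

text \<open>Under concatenation words form a monoid, and the convolution product of
  \<open>Poly_Mapping\<close> is then the product \<open>tmul\<close> of the tensor algebra.\<close>
instantiation list :: (type) monoid_add
begin

definition plus_list :: "'a list \<Rightarrow> 'a list \<Rightarrow> 'a list" where
  "plus_list u v = u @ v"

definition zero_list :: "'a list" where
  "zero_list = []"

instance by standard (simp_all add: plus_list_def zero_list_def)

end

abbreviation keys where "keys \<equiv> Poly_Mapping.keys"
abbreviation single where "single \<equiv> Poly_Mapping.single"
abbreviation lookup where "lookup \<equiv> Poly_Mapping.lookup"

lemma single_mult_single: "single u a * single v b = single (u @ v) (a * b)"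
  by (simp add: mult_single plus_list_def)

lemma one_tens: "(1 :: 'a list \<Rightarrow>\<^sub>0 complex) = single [] 1"
  by (simp add: zero_list_def flip: single_one)

lemma poly_mapping_sum_single: "a = (\<Sum>w\<in>keys a. single w (lookup a w))"
  by (rule poly_mapping_eqI) (auto simp: lookup_sum lookup_single when_def in_keys_iff)

lemma times_conv_sum:
  fixes a b :: "'a list \<Rightarrow>\<^sub>0 complex"
  shows "a * b = (\<Sum>u\<in>keys a. \<Sum>v\<in>keys b. single (u @ v) (lookup a u * lookup b v))"
proof -
  have "a * b = (\<Sum>u\<in>keys a. single u (lookup a u)) * (\<Sum>v\<in>keys b. single v (lookup b v))"
    by (simp flip: poly_mapping_sum_single)
  then show ?thesis by (simp add: sum_product single_mult_single)
qed

lemma tmul_eq_times: "tmul a b = a * b"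
  by (simp add: tmul_def times_conv_sum)

lemma tscal_add: "tscal (a + b) = tscal a + tscal b"
  by (simp add: tscal_def single_add)

lemma tscal_mult: "tscal (a * b) = tscal a * tscal b"
  by (simp add: tscal_def single_mult_single)

lemma tscal_0 [simp]: "tscal 0 = 0"
  by (simp add: tscal_def)

lemma tscal_1 [simp]: "tscal 1 = 1"
  by (simp add: tscal_def one_tens)

lemma tscal_uminus: "tscal (- a) = - tscal a"
  by (simp add: tscal_def single_uminus)

lemma tscal_sum: "tscal (sum f A) = (\<Sum>i\<in>A. tscal (f i))"
  by (induction A rule: infinite_finite_induct) (auto simp: tscal_add)

lemma tscal_commute: "x * tscal c = tscal c * x"
proof -
  have "(\<Sum>w\<in>keys x. single w (lookup x w)) * tscal c = tscal c * (\<Sum>w\<in>keys x. single w (lookup x w))"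
    by (simp add: sum_distrib_left sum_distrib_right tscal_def single_mult_single mult.commute)
  then show ?thesis by (simp flip: poly_mapping_sum_single)
qed

lemma tscal_times_single: "tscal c * single w a = single w (c * a)"
  by (simp add: tscal_def single_mult_single)

section \<open>Linear functionals on formal combinations\<close>

definition lin :: "('a \<Rightarrow> complex) \<Rightarrow> ('a \<Rightarrow>\<^sub>0 complex) \<Rightarrow> complex" where
  "lin f a = (\<Sum>w\<in>keys a. lookup a w * f w)"

text \<open>As a \<open>fundef_cong\<close> rule it lets a recursive call under \<open>lin\<close>
  assume that its word lies in the support; the termination of \<open>ell\<close> rests on
  this.\<close>

lemma lin_cong [fundef_cong]:
  "a = b \<Longrightarrow> (\<And>w. w \<in> keys b \<Longrightarrow> f w = g w) \<Longrightarrow> lin f a = lin g b"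
  by (simp add: lin_def)

lemma lin_superset: "finite A \<Longrightarrow> keys a \<subseteq> A \<Longrightarrow> lin f a = (\<Sum>w\<in>A. lookup a w * f w)"
  unfolding lin_def by (intro sum.mono_neutral_left) (auto simp: in_keys_iff)

lemma lin_zero [simp]: "lin f 0 = 0"
  by (simp add: lin_def)

lemma lin_single [simp]: "lin f (single w c) = c * f w"
  by (simp add: lin_def)

lemma lin_add [simp]: "lin f (a + b) = lin f a + lin f b"
proof -
  have "lin f (a + b) = (\<Sum>w\<in>keys a \<union> keys b. lookup (a + b) w * f w)"
    using keys_add[of a b] by (intro lin_superset) auto
  moreover have "lin f a = (\<Sum>w\<in>keys a \<union> keys b. lookup a w * f w)" by (intro lin_superset) auto
  moreover have "lin f b = (\<Sum>w\<in>keys a \<union> keys b. lookup b w * f w)" by (intro lin_superset) auto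
  ultimately show ?thesis by (simp add: lookup_add distrib_right sum.distrib)
qed

lemma lin_uminus [simp]: "lin f (- a) = - lin f a"
  using lin_add[of f a "- a"] by (simp add: eq_neg_iff_add_eq_0 add.commute)

lemma lin_diff [simp]: "lin f (a - b) = lin f a - lin f b"
  using lin_add[of f a "- b"] by simp

lemma lin_sum: "lin f (sum a A) = (\<Sum>i\<in>A. lin f (a i))"
  by (induction A rule: infinite_finite_induct) auto

lemma lin_fun_add: "lin (\<lambda>w. f w + g w) a = lin f a + lin g a"
  by (simp add: lin_def distrib_left sum.distrib)

lemma lin_fun_diff: "lin (\<lambda>w. f w - g w) a = lin f a - lin g a"
  by (simp add: lin_def right_diff_distrib sum_subtractf)

lemma lin_fun_scale: "lin (\<lambda>w. c * f w) a = c * lin f a"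
  by (simp add: lin_def sum_distrib_left mult.left_commute)

lemma lin_fun_zero [simp]: "lin (\<lambda>w. 0) a = 0"
  by (simp add: lin_def)

lemma lin_swap: "lin (\<lambda>u. lin (\<lambda>v. f u v) b) a = lin (\<lambda>v. lin (\<lambda>u. f u v) a) b"
  unfolding lin_def sum_distrib_left by (subst sum.swap) (simp add: mult.left_commute)

lemma lin_times: "lin f (a * b) = lin (\<lambda>u. lin (\<lambda>v. f (u @ v)) b) a"
  by (simp add: times_conv_sum lin_sum) (simp add: lin_def sum_distrib_left mult.assoc)

section \<open>The bracket on basis elements: antisymmetry and the Jacobi identity\<close>

lemma lin_br_simps:
  "lin f (br (D m) (D n)) = of_int (m - n) * f [D (m + n)]
    + (if m + n = 0 then of_int (m ^ 3 - m) / 12 else 0) * f [C]"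
  "lin f (br (D m) (H n)) = - (of_int n + 1/2) * f [H (m + n)]"
  "lin f (br (H n) (D m)) = (of_int n + 1/2) * f [H (m + n)]"
  "lin f (br (H n) (H k)) = (if n + k = -1 then of_int n + 1/2 else 0) * f [L]"
  "lin f (br C x) = 0" "lin f (br x C) = 0" "lin f (br L x) = 0" "lin f (br x L) = 0"
  by (auto simp del: of_int_diff of_int_power)

lemma br_antisym: "br y x = - br x y"
proof -
  have DD: "br (D n) (D m) = - br (D m) (D n)" for m n
  proof (cases "m + n = 0")
    case True
    then have n: "n = - m" by simp
    show ?thesis by (simp add: n flip: single_uminus) (simp add: minus_divide_left)
  next
    case False
    then show ?thesis by (simp add: add.commute flip: single_uminus)
  qed
  have HH: "br (H n) (H m) = - br (H m) (H n)" for m n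
  proof (cases "m + n = -1")
    case True
    then have n: "n = - 1 - m" by simp
    show ?thesis
      by (simp add: n flip: single_uminus) (rule arg_cong[of _ _ "single [L]"], simp)
  next
    case False
    then show ?thesis by (simp add: add.commute)
  qed
  show ?thesis
    by (cases x; cases y; simp only:; (rule DD HH | simp add: add.commute flip: single_uminus))
qed

lemma br_self: "br x x = 0"
proof (cases x)
  case (H n)
  have "n + n \<noteq> - 1" by presburger
  then show ?thesis by (simp add: H)
qed auto

text \<open>The bracket stays in the span of the letters, so replacing two adjacent letters by their
  bracket shortens a word.\<close>

lemma br_keys_singleton:
  assumes "w \<in> keys (br x y)" shows "\<exists>b. w = [b]"
  using assms by (cases x; cases y) (auto split: if_splits dest!: subsetD[OF keys_add])

declare br.simps [simp del]

text \<open>The adjoint action of \<open>a\<close> is a derivation, tested against an arbitrary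
  functional. The words in a bracket have one letter, which \<open>hd\<close> recovers.\<close>

lemma br_jacobi:
  "lin (\<lambda>b. lin f (br (hd b) y)) (br a x) + lin (\<lambda>b. lin f (br x (hd b))) (br a y)
    = lin (\<lambda>b. lin f (br a (hd b))) (br x y)"
proof -
  have DDD: ?thesis if e: "a = D i" "x = D j" "y = D k" for i j k
  \<comment> \<open>The central term occurs only when the indices sum to zero; there the identity is
    one between cubic polynomials in two indices.\<close>
  proof (cases "i + j + k = 0")
    case True
    then have k: "k = - i - j" by simp
    show ?thesis unfolding e k by (simp add: lin_br_simps split del: if_split) (simp add: field_simps power3_eq_cube)
  next
    case False
    then have F: "i + j + k \<noteq> 0" "j + (i + k) \<noteq> 0" "i + (j + k) \<noteq> 0" by auto
    have c: "D (i + j + k) = D (i + (j + k))" "D (j + (i + k)) = D (i + (j + k))" by auto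
    show ?thesis unfolding e using F by (simp add: lin_br_simps c) (simp add: algebra_simps)
  qed
  have c: "H (i + j + k) = H (i + (j + k))" "H (j + (i + k)) = H (i + (j + k))"
    "H (j + i + k) = H (i + (j + k))" for i j k by auto
  have DHH: ?thesis if e: "a = D i" "x = H j" "y = H k" for i j k
  \<comment> \<open>\<open>H j\<close> stands for the index \<open>j + 1/2\<close>, so the total
    index is zero exactly when \<open>i + j + k = -1\<close>.\<close>
  proof (cases "i + j + k = -1")
    case True
    then have k: "k = - 1 - i - j" by simp
    show ?thesis unfolding e k by (auto simp: lin_br_simps field_simps)
  next
    case False
    then have F: "i + j + k \<noteq> -1" "j + (i + k) \<noteq> -1" "i + (j + k) \<noteq> -1" by auto
    show ?thesis unfolding e using F by (simp add: lin_br_simps)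
  qed
  have HDH: ?thesis if e: "a = H j" "x = D i" "y = H k" for i j k
  proof (cases "i + j + k = -1")
    case True
    then have k: "k = - 1 - i - j" by simp
    show ?thesis unfolding e k by (auto simp: lin_br_simps field_simps)
  next
    case False
    then have F: "i + j + k \<noteq> -1" "j + (i + k) \<noteq> -1" "i + (j + k) \<noteq> -1" by auto
    show ?thesis unfolding e using F by (simp add: lin_br_simps)
  qed
  have HHD: ?thesis if e: "a = H j" "x = H k" "y = D i" for i j k
  proof (cases "i + j + k = -1")
    case True
    then have k: "k = - 1 - i - j" by simp
    show ?thesis unfolding e k by (auto simp: lin_br_simps field_simps)
  next
    case False
    then have F: "i + j + k \<noteq> -1" "k + (i + j) \<noteq> -1" "j + (i + k) \<noteq> -1" "i + (j + k) \<noteq> -1" by auto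
    show ?thesis unfolding e using F by (simp add: lin_br_simps)
  qed
  show ?thesis
  proof (cases a; cases x; cases y)
    fix i j k assume e: "a = D i" "x = D j" "y = H k"
    show ?thesis unfolding e by (auto simp: lin_br_simps c) (simp_all add: field_simps)
  next
    fix i j k assume e: "a = D i" "x = H k" "y = D j"
    show ?thesis unfolding e by (auto simp: lin_br_simps c add.commute) (simp_all add: field_simps)
  next
    fix i j k assume e: "a = H k" "x = D i" "y = D j"
    show ?thesis unfolding e by (auto simp: lin_br_simps c) (simp_all add: field_simps)
  qed ((rule DDD DHH HDH HHD; assumption) | simp add: lin_br_simps)+
qed

section \<open>A normal form functional\<close>

text \<open>At the right end of a word an element of \<open>\<pp>\<close> is rewritten to its value under \<open>\<phi>\<close> and \<open>d\<^sub>m\<close>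
  with \<open>m \<in> T\<close> to \<open>r\<close>; elsewhere adjacent letters are put in order. For \<open>T = {m}\<close> this computes in the
  module induced from the character of \<open>\<complex>(d\<^sub>m - r) + \<pp>\<close> extending \<open>\<phi>\<close>, and for \<open>T = {}\<close> in \<open>W(\<phi>)\<close>.\<close>
locale whittaker_rewriting =
  fixes \<phi> :: "gen \<Rightarrow> complex" and T :: "int set" and r :: tens
  assumes phi_L: "\<phi> L = 0"
    and T_subsingleton: "m \<in> T \<Longrightarrow> m' \<in> T \<Longrightarrow> m = m'"
    and r_keys: "t \<in> keys r \<Longrightarrow> t = [] \<or> (\<exists>m. t = [D m] \<and> m \<notin> T)"
    and r_compatible:
      "m \<in> T \<Longrightarrow> lin (\<lambda>t. case t of [D k] \<Rightarrow> \<phi> (H (k + n)) | _ \<Rightarrow> 0) r = \<phi> (H (m + n))"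
begin

text \<open>Sorted words increase in \<open>key\<close>: free letters \<open>D m\<close> first, then
  the special one, then \<pp>. Letters that can be evaluated thus collect at the right end.\<close>

definition key :: "gen \<Rightarrow> nat \<times> int" where
  "key x = (case x of D m \<Rightarrow> (if m \<in> T then 1 else 0, m) | H n \<Rightarrow> (2, n) | C \<Rightarrow> (3, 0) | L \<Rightarrow> (4, 0))"

lemma key_eq_iff: "key x = key y \<longleftrightarrow> x = y"
  by (cases x; cases y) (auto simp: key_def)

definition trailing :: "gen \<Rightarrow> bool" where
  "trailing x \<longleftrightarrow> in_p x \<or> (\<exists>m\<in>T. x = D m)"

definition reduct :: "gen \<Rightarrow> tens" where
  "reduct x = (if in_p x then tscal (\<phi> x) else r)"

fun inversions :: "gen list \<Rightarrow> nat" where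
  "inversions [] = 0"
| "inversions (x # w) = length (filter (\<lambda>y. key y < key x) w) + inversions w"

lemma inversions_swap:
  "key y < key x \<Longrightarrow> inversions (u @ x # y # v) = Suc (inversions (u @ y # x # v))"
  by (induction u) auto

text \<open>A termination measure: rewriting a special letter by \<open>r\<close> may preserve the
  length of the word, but the letters of \<open>r\<close> are not special.\<close>

definition special :: "gen list \<Rightarrow> nat" where
  "special w = length (filter (\<lambda>x. \<exists>m\<in>T. x = D m) w)"

definition descent :: "gen list \<Rightarrow> gen list \<times> gen \<times> gen \<times> gen list \<Rightarrow> bool" where
  "descent w = (\<lambda>(u, x, y, v). w = u @ x # y # v \<and> key y < key x)"

text \<open>Always taking the leftmost descent makes the rewriting deterministic, so
  \<open>ell\<close> is a function from the outset and confluence becomes a statement about its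
  values.\<close>

definition first_descent :: "gen list \<Rightarrow> gen list \<times> gen \<times> gen \<times> gen list" where
  "first_descent w = arg_min (\<lambda>(u, x, y, v). length u) (descent w)"

lemma first_descent:
  assumes "descent w d"
  shows "descent w (first_descent w)" "length (fst (first_descent w)) \<le> length (fst d)"
proof -
  have e: "(\<lambda>(u, x, y, v). length u) = (\<lambda>d :: gen list \<times> gen \<times> gen \<times> gen list. length (fst d))"
    by auto
  show "descent w (first_descent w)" "length (fst (first_descent w)) \<le> length (fst d)"
    using arg_min_nat_lemma[of "descent w" d "\<lambda>d. length (fst d)"] assms
    unfolding first_descent_def e by blast+
qed

lemma special_swap: "special (u @ x # y # v) = special (u @ y # x # v)"
  by (simp add: special_def)

text \<open>The coefficient of the empty word in the normal form. The final value 0 belongs to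
  sorted nonempty words with no trailing letter at the end, which are the other normal
  words.\<close>

function ell :: "gen list \<Rightarrow> complex" where
  "ell w =
    (if w = [] then 1
     else if trailing (last w) then lin (\<lambda>t. ell (butlast w @ t)) (reduct (last w))
     else if (\<exists>d. descent w d) then
       (case first_descent w of (u, x, y, v) \<Rightarrow> ell (u @ y # x # v) + lin (\<lambda>b. ell (u @ b @ v)) (br x y))
     else 0)"
  by auto
termination
\<comment> \<open>Evaluating a letter of \<pp> and taking a bracket shorten the word, rewriting a
  special letter lowers \<open>special\<close> if the length stays, and a swap lowers
  \<open>inversions\<close> alone.\<close>
proof (relation "measures [length, special, inversions]")
  fix w t
  assume w: "w \<noteq> []" "trailing (last w)" "t \<in> keys (reduct (last w))"
  then obtain u x where ux: "w = u @ [x]" by (metis append_butlast_last_id)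
  show "(butlast w @ t, w) \<in> measures [length, special, inversions]"
  proof (cases "in_p x")
    case True
    with w ux have "t = []" by (auto simp: reduct_def tscal_def split: if_splits)
    then show ?thesis by (simp add: ux)
  next
    case False
    with w ux obtain m where "x = D m" "m \<in> T" by (auto simp: trailing_def)
    moreover have "t = [] \<or> (\<exists>m. t = [D m] \<and> m \<notin> T)" using w ux False r_keys by (simp add: reduct_def)
    ultimately show ?thesis by (auto simp: ux special_def)
  qed
next
  fix w u d x d' y v
  assume "\<exists>d. descent w d" "(u, d) = first_descent w" "(x, d') = d" "(y, v) = d'"
  then have "descent w (u, x, y, v)" using first_descent(1) by metis
  then show "(u @ y # x # v, w) \<in> measures [length, special, inversions]"
    by (auto simp: descent_def special_swap inversions_swap)
next
  fix w u d x d' y v b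
  assume "\<exists>d. descent w d" "(u, d) = first_descent w" "(x, d') = d" "(y, v) = d'"
    and b: "b \<in> keys (br x y)"
  then have "descent w (u, x, y, v)" using first_descent(1) by metis
  then show "(u @ b @ v, w) \<in> measures [length, special, inversions]"
    using br_keys_singleton[OF b] by (auto simp: descent_def)
qed simp

declare ell.simps [simp del]

lemma ell_Nil [simp]: "ell [] = 1"
  by (simp add: ell.simps)

lemma ell_snoc_p: "in_p x \<Longrightarrow> ell (u @ [x]) = \<phi> x * ell u"
  by (subst ell.simps) (simp add: trailing_def reduct_def tscal_def)

lemma ell_snoc_special: "m \<in> T \<Longrightarrow> ell (u @ [D m]) = lin (\<lambda>t. ell (u @ t)) r"
  by (subst ell.simps) (simp add: trailing_def reduct_def in_p_def)

lemma ell_descent: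
  assumes "descent w d" "\<not> trailing (last w)"
  obtains u x y v where "w = u @ x # y # v" "key y < key x" "length u \<le> length (fst d)"
    "ell w = ell (u @ y # x # v) + lin (\<lambda>b. ell (u @ b @ v)) (br x y)"
proof -
  obtain u x y v where d: "first_descent w = (u, x, y, v)" by (cases "first_descent w")
  have 1: "w = u @ x # y # v" "key y < key x"
    using first_descent(1)[OF assms(1)] by (auto simp: d descent_def)
  have 2: "length u \<le> length (fst d)" using first_descent(2)[OF assms(1)] d by simp
  have ex: "\<exists>d. descent w d" using assms(1) by blast
  have nonempty: "w \<noteq> []" using 1 by simp
  have "ell w = ell (u @ y # x # v) + lin (\<lambda>b. ell (u @ b @ v)) (br x y)"
    using ex assms(2) nonempty by (subst ell.simps) (simp add: d del: split_paired_Ex)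
  then show thesis using that 1 2 by blast
qed

definition swap_rel :: "gen list \<Rightarrow> gen \<Rightarrow> gen \<Rightarrow> gen list \<Rightarrow> bool" where
  "swap_rel u x y v \<longleftrightarrow>
     ell (u @ x # y # v) - ell (u @ y # x # v) = lin (\<lambda>b. ell (u @ b @ v)) (br x y)"

lemma swap_rel_sym: "swap_rel u y x v \<Longrightarrow> swap_rel u x y v"
  using br_antisym[of x y] unfolding swap_rel_def by (simp add: algebra_simps)

lemma swap_rel_same: "swap_rel u x x v"
  by (simp add: swap_rel_def br_self)

text \<open>The descent rewritten by \<open>ell\<close> is the leftmost one. If it overlaps the given one, the claim
  reduces to the Jacobi identity; if the two are disjoint, they commute by induction.\<close>
lemma swap_rel_descent:
  assumes "key y < key x"
  shows "swap_rel u x y v"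
proof -
  have "\<forall>u x y v. w = u @ x # y # v \<longrightarrow> key y < key x \<longrightarrow> swap_rel u x y v" for w
  proof (induction w rule: wf_induct[OF wf_measures[of "[length, special, inversions]"]])
    case (1 w)
    have IH: "swap_rel u x y v"
      if "(u @ x # y # v, w) \<in> measures [length, special, inversions]" "key y < key x" for u x y v
      using 1 that by blast
    \<comment> \<open>For shorter words the order of the two letters is immaterial, by antisymmetry
      of the bracket.\<close>
    have IHlen: "swap_rel u x y v" if "length (u @ x # y # v) < length w" for u x y v
    proof -
      consider "key y < key x" | "key x < key y" | "x = y" using key_eq_iff by fastforce
      then show ?thesis
      proof cases
        case 2
        then show ?thesis using that by (intro swap_rel_sym[OF IH]) auto
      qed (use that in \<open>auto intro: IH swap_rel_same\<close>)
    qed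
    show ?case
    proof (intro allI impI)
      fix u x y v
      assume w: "w = u @ x # y # v" and xy: "key y < key x"
      \<comment> \<open>\<open>ell\<close> inspects the last letter first: either it is evaluated,
        lying beyond the pair or being \<open>y\<close> itself, or a descent is rewritten.\<close>
      consider (tail) v' z where "v = v' @ [z]" "trailing z" | (edge) "v = []" "trailing y"
        | (inner) "\<not> trailing (last w)"
        by (cases v rule: rev_cases) (auto simp: w)
      then show "swap_rel u x y v"
      proof cases
        case tail
        show ?thesis
        proof (cases "in_p z")
          case True
          have "swap_rel u x y v'" by (rule IHlen) (simp add: w tail)
          then show ?thesis
            using ell_snoc_p[OF True, of "u @ x # y # v'"] ell_snoc_p[OF True, of "u @ y # x # v'"]
              ell_snoc_p[OF True, of "u @ _ @ v'"]
            by (simp add: swap_rel_def tail lin_fun_scale flip: right_diff_distrib)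
        next
          case False
          then obtain m where m: "z = D m" "m \<in> T" using tail by (auto simp: trailing_def)
          have "swap_rel u x y (v' @ t)" if t: "t \<in> keys r" for t
            using r_keys[OF t] m by (intro IH xy) (auto simp: w tail special_def)
          then have *: "ell (u @ x # y # v' @ t) - ell (u @ y # x # v' @ t)
              = lin (\<lambda>b. ell (u @ b @ v' @ t)) (br x y)" if "t \<in> keys r" for t
            using that unfolding swap_rel_def by blast
          have "lin (\<lambda>t. ell (u @ x # y # v' @ t)) r - lin (\<lambda>t. ell (u @ y # x # v' @ t)) r
              = lin (\<lambda>t. lin (\<lambda>b. ell (u @ b @ v' @ t)) (br x y)) r"
            unfolding lin_fun_diff[symmetric] by (rule lin_cong[OF refl *])
          also have "\<dots> = lin (\<lambda>b. lin (\<lambda>t. ell (u @ b @ v' @ t)) r) (br x y)" by (rule lin_swap)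
          finally show ?thesis
            using ell_snoc_special[OF m(2), of "u @ x # y # v'"] ell_snoc_special[OF m(2), of "u @ y # x # v'"]
              ell_snoc_special[OF m(2), of "u @ _ @ v'"]
            by (simp add: swap_rel_def tail m)
        qed
      next
        case edge
        \<comment> \<open>\<open>x\<close> exceeds the trailing letter \<open>y\<close>, and among
          the letters \<open>D m\<close> at most one is special, so \<open>x\<close> must come from
          \<pp>.\<close>
        have px: "in_p x"
          using edge xy T_subsingleton by (cases x; cases y) (auto simp: trailing_def key_def in_p_def split: if_splits)
        show ?thesis
        proof (cases "in_p y")
          case True
          \<comment> \<open>Brackets within \<pp> are multiples of \<open>L\<close>, on which \<phi>
            vanishes.\<close>
          have "lin (\<lambda>b. ell (u @ b)) (br x y) = 0"
            using px True phi_L ell_snoc_p[of L u]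
            by (cases x; cases y) (auto simp: in_p_def lin_br_simps)
          then show ?thesis
            using ell_snoc_p[OF True, of "u @ [x]"] ell_snoc_p[OF px, of "u @ [y]"]
              ell_snoc_p[OF True, of u] ell_snoc_p[OF px, of u]
            by (simp add: swap_rel_def edge)
        next
          case False
          then obtain m where m: "y = D m" "m \<in> T" using edge by (auto simp: trailing_def)
          \<comment> \<open>\<open>g t\<close> is the bracket term that arises when \<open>x\<close>
            is moved to the right past a word \<open>t\<close> of \<open>r\<close>.\<close>
          define g where "g t = (case t of [D k] \<Rightarrow> lin (\<lambda>b. ell (u @ b)) (br x (D k)) | _ \<Rightarrow> 0)" for t
          have "ell (u @ x # t) = \<phi> x * ell (u @ t) + g t" if t: "t \<in> keys r" for t
          proof -
            consider "t = []" | k where "t = [D k]" "k \<notin> T" using r_keys[OF t] by blast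
            then show ?thesis
            proof cases
              case 1
              then show ?thesis using ell_snoc_p[OF px, of u] by (simp add: g_def)
            next
              case 2
              have "swap_rel u x (D k) []"
                using px m 2 by (intro IH) (auto simp: w edge special_def key_def in_p_def split: gen.splits)
              then show ?thesis using ell_snoc_p[OF px, of "u @ [D k]"]
                by (simp add: swap_rel_def 2 g_def algebra_simps)
            qed
          qed
          then have "lin (\<lambda>t. ell (u @ x # t)) r = lin (\<lambda>t. \<phi> x * ell (u @ t) + g t) r"
            by (rule lin_cong[OF refl])
          also have "\<dots> = \<phi> x * ell (u @ [D m]) + lin g r"
            by (simp add: lin_fun_add lin_fun_scale ell_snoc_special[OF m(2)])
          \<comment> \<open>This is where \<open>r_compatible\<close> enters: \<phi> takes the same
            value on the bracket of \<open>x\<close> with \<open>r\<close> as on that with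
            \<open>D m\<close>.\<close>
          also have "lin g r = lin (\<lambda>b. ell (u @ b)) (br x (D m))"
          proof (cases x)
            case (H n)
            have g: "g = (\<lambda>t. (of_int n + 1/2) * ell u * (case t of [D k] \<Rightarrow> \<phi> (H (k + n)) | _ \<Rightarrow> 0))"
              by (auto simp: g_def H lin_br_simps ell_snoc_p in_p_def fun_eq_iff split: list.splits gen.splits)
            show ?thesis unfolding g lin_fun_scale r_compatible[OF m(2)]
              by (simp add: H lin_br_simps ell_snoc_p in_p_def)
          next
            case (D k)
            then show ?thesis using px by (simp add: in_p_def)
          next
            case C
            then have "g = (\<lambda>t. 0)" by (auto simp: g_def lin_br_simps fun_eq_iff split: list.splits gen.splits)
            then show ?thesis by (simp add: C lin_br_simps)
          next
            case L
            then have "g = (\<lambda>t. 0)" by (auto simp: g_def lin_br_simps fun_eq_iff split: list.splits gen.splits)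
            then show ?thesis by (simp add: L lin_br_simps)
          qed
          finally have "lin (\<lambda>t. ell (u @ x # t)) r
            = \<phi> x * ell (u @ [D m]) + lin (\<lambda>b. ell (u @ b)) (br x (D m))" .
          then show ?thesis
            using ell_snoc_special[OF m(2), of "u @ [x]"] ell_snoc_p[OF px, of "u @ [D m]"]
            by (simp add: swap_rel_def edge m)
        qed
      next
        case inner
        have dw: "descent w (u, x, y, v)" using w xy by (simp add: descent_def)
        obtain u0 x0 y0 v0 where w0: "w = u0 @ x0 # y0 # v0" and key0: "key y0 < key x0"
          and len0: "length u0 \<le> length u"
          and ell0: "ell w = ell (u0 @ y0 # x0 # v0) + lin (\<lambda>b. ell (u0 @ b @ v0)) (br x0 y0)"
          by (rule ell_descent[OF dw inner]) (rule that; simp)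
        have "u0 @ x0 # y0 # v0 = u @ x # y # v" using w w0 by simp
        with len0 obtain us where us: "u = u0 @ us" "x0 # y0 # v0 = us @ x # y # v"
          by (auto simp: append_eq_append_conv2)
        \<comment> \<open>The leftmost descent is the given pair, overlaps it in one letter, or lies
          entirely to its left.\<close>
        consider "us = []" | "us = [x0]" "y0 = x" "v0 = y # v"
          | s where "us = x0 # y0 # s" "v0 = s @ x # y # v"
          using us(2) by (cases us; cases "tl us") auto
        then show ?thesis
        proof cases
          case 1
          then show ?thesis using us ell0 w by (simp add: swap_rel_def)
        next
          case 2
          note w2 = w us(1) 2
          have key2: "key x < key x0" "key y < key x0" using key0 xy 2 by auto
          \<comment> \<open>Here \<open>x0\<close>, \<open>x\<close>, \<open>y\<close> is a
            descending triple. Both arrangements are sorted down to \<open>y\<close>,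
            \<open>x\<close>, \<open>x0\<close>: one by \<open>e1\<close> to \<open>e3\<close>, the
            other by \<open>e4\<close> and \<open>e5\<close>. The leftover brackets combine into
            double brackets by \<open>e6\<close> to \<open>e8\<close>, and these cancel by the
            Jacobi identity.\<close>
          have e1: "ell (u0 @ x0 # x # y # v)
              = ell (u0 @ x # x0 # y # v) + lin (\<lambda>b. ell (u0 @ b @ y # v)) (br x0 x)"
            using ell0 w2 by simp
          have "swap_rel (u0 @ [x]) x0 y v"
            using inversions_swap[of x x0 u0 "y # v"] special_swap[of u0 x0 x "y # v"] key2
            by (intro IH) (auto simp: w2)
          then have e2: "ell (u0 @ x # x0 # y # v) - ell (u0 @ x # y # x0 # v)
              = lin (\<lambda>b. ell (u0 @ x # b @ v)) (br x0 y)" by (simp add: swap_rel_def)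
          have "swap_rel u0 x y (x0 # v)"
            using inversions_swap[of x x0 u0 "y # v"] special_swap[of u0 x0 x "y # v"]
              inversions_swap[of y x0 "u0 @ [x]" v] special_swap[of "u0 @ [x]" x0 y v] key2 xy
            by (intro IH) (auto simp: w2)
          then have e3: "ell (u0 @ x # y # x0 # v) - ell (u0 @ y # x # x0 # v)
              = lin (\<lambda>b. ell (u0 @ b @ x0 # v)) (br x y)" by (simp add: swap_rel_def)
          have "swap_rel u0 x0 y (x # v)"
            using inversions_swap[of y x "u0 @ [x0]" v] special_swap[of "u0 @ [x0]" x y v] key2 xy
            by (intro IH) (auto simp: w2)
          then have e4: "ell (u0 @ x0 # y # x # v) - ell (u0 @ y # x0 # x # v)
              = lin (\<lambda>b. ell (u0 @ b @ x # v)) (br x0 y)" by (simp add: swap_rel_def)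
          have "swap_rel (u0 @ [y]) x0 x v"
            using inversions_swap[of y x "u0 @ [x0]" v] special_swap[of "u0 @ [x0]" x y v]
              inversions_swap[of y x0 u0 "x # v"] special_swap[of u0 x0 y "x # v"] key2 xy
            by (intro IH) (auto simp: w2)
          then have e5: "ell (u0 @ y # x0 # x # v) - ell (u0 @ y # x # x0 # v)
              = lin (\<lambda>b. ell (u0 @ y # b @ v)) (br x0 x)" by (simp add: swap_rel_def)
          have short: "ell (u0 @ b # c # v) - ell (u0 @ c # b # v) = lin (\<lambda>b. ell (u0 @ b @ v)) (br b c)" for b c
            using IHlen[of u0 b c v] by (simp add: w2 swap_rel_def)
          have e6: "lin (\<lambda>b. ell (u0 @ b @ y # v)) (br x0 x) - lin (\<lambda>b. ell (u0 @ y # b @ v)) (br x0 x)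
              = lin (\<lambda>b. lin (\<lambda>b. ell (u0 @ b @ v)) (br (hd b) y)) (br x0 x)"
            unfolding lin_fun_diff[symmetric]
            by (rule lin_cong[OF refl]) (use short in \<open>auto dest!: br_keys_singleton\<close>)
          have e7: "lin (\<lambda>b. ell (u0 @ x # b @ v)) (br x0 y) - lin (\<lambda>b. ell (u0 @ b @ x # v)) (br x0 y)
              = lin (\<lambda>b. lin (\<lambda>b. ell (u0 @ b @ v)) (br x (hd b))) (br x0 y)"
            unfolding lin_fun_diff[symmetric]
            by (rule lin_cong[OF refl]) (use short in \<open>auto dest!: br_keys_singleton\<close>)
          have e8: "lin (\<lambda>b. ell (u0 @ x0 # b @ v)) (br x y) - lin (\<lambda>b. ell (u0 @ b @ x0 # v)) (br x y)
              = lin (\<lambda>b. lin (\<lambda>b. ell (u0 @ b @ v)) (br x0 (hd b))) (br x y)"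
            unfolding lin_fun_diff[symmetric]
            by (rule lin_cong[OF refl]) (use short in \<open>auto dest!: br_keys_singleton\<close>)
          have "ell (u0 @ x0 # x # y # v) - ell (u0 @ x0 # y # x # v)
              = lin (\<lambda>b. ell (u0 @ x0 # b @ v)) (br x y)"
            using e1 e2 e3 e4 e5 e6 e7 e8 br_jacobi[of "\<lambda>b. ell (u0 @ b @ v)" y x0 x] by algebra
          then show ?thesis by (simp add: swap_rel_def us(1) 2)
        next
          case 3
          note w3 = w us(1) 3
          \<comment> \<open>Rewriting at the two disjoint places in either order leaves the same
            double bracket terms, up to the order of the two sums.\<close>
          have e1: "ell (u0 @ x0 # y0 # s @ x # y # v)
              = ell (u0 @ y0 # x0 # s @ x # y # v) + lin (\<lambda>b. ell (u0 @ b @ s @ x # y # v)) (br x0 y0)"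
            using ell0 w3 by simp
          have "swap_rel (u0 @ y0 # x0 # s) x y v"
            using inversions_swap[of y0 x0 u0 "s @ x # y # v"] special_swap[of u0 x0 y0 "s @ x # y # v"] key0 xy
            by (intro IH) (auto simp: w3)
          then have e2: "ell (u0 @ y0 # x0 # s @ x # y # v) - ell (u0 @ y0 # x0 # s @ y # x # v)
              = lin (\<lambda>b. ell (u0 @ y0 # x0 # s @ b @ v)) (br x y)" by (simp add: swap_rel_def)
          have "swap_rel u0 x0 y0 (s @ y # x # v)"
            using inversions_swap[of y x "u0 @ x0 # y0 # s" v] special_swap[of "u0 @ x0 # y0 # s" x y v] key0 xy
            by (intro IH) (auto simp: w3)
          then have e3: "ell (u0 @ x0 # y0 # s @ y # x # v) - ell (u0 @ y0 # x0 # s @ y # x # v)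
              = lin (\<lambda>b. ell (u0 @ b @ s @ y # x # v)) (br x0 y0)" by (simp add: swap_rel_def)
          have *: "ell (u0 @ b @ s @ x # y # v) - ell (u0 @ b @ s @ y # x # v)
              = lin (\<lambda>c. ell (u0 @ b @ s @ c @ v)) (br x y)" if "b \<in> keys (br x0 y0)" for b
            using IHlen[of "u0 @ b @ s" x y v] br_keys_singleton[OF that] by (auto simp: w3 swap_rel_def)
          have e4: "lin (\<lambda>b. ell (u0 @ b @ s @ x # y # v)) (br x0 y0) - lin (\<lambda>b. ell (u0 @ b @ s @ y # x # v)) (br x0 y0)
              = lin (\<lambda>b. lin (\<lambda>c. ell (u0 @ b @ s @ c @ v)) (br x y)) (br x0 y0)"
            unfolding lin_fun_diff[symmetric] by (rule lin_cong[OF refl *])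
          have **: "ell (u0 @ x0 # y0 # s @ c @ v) - ell (u0 @ y0 # x0 # s @ c @ v)
              = lin (\<lambda>b. ell (u0 @ b @ s @ c @ v)) (br x0 y0)" if "c \<in> keys (br x y)" for c
            using IHlen[of u0 x0 y0 "s @ c @ v"] br_keys_singleton[OF that] by (auto simp: w3 swap_rel_def)
          have e5: "lin (\<lambda>c. ell (u0 @ x0 # y0 # s @ c @ v)) (br x y) - lin (\<lambda>c. ell (u0 @ y0 # x0 # s @ c @ v)) (br x y)
              = lin (\<lambda>c. lin (\<lambda>b. ell (u0 @ b @ s @ c @ v)) (br x0 y0)) (br x y)"
            unfolding lin_fun_diff[symmetric] by (rule lin_cong[OF refl **])
          have "ell (u0 @ x0 # y0 # s @ x # y # v) - ell (u0 @ x0 # y0 # s @ y # x # v)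
              = lin (\<lambda>b. ell (u0 @ x0 # y0 # s @ b @ v)) (br x y)"
            using e1 e2 e3 e4 e5[unfolded lin_swap[of _ "br x0 y0" "br x y"]] by algebra
          then show ?thesis by (simp add: swap_rel_def us(1) 3)
        qed
      qed
    qed
  qed
  then show ?thesis using assms by blast
qed

section \<open>The left ideal attached to the functional\<close>

lemma ell_commutator:
  "ell (u @ x # y # v) - ell (u @ y # x # v) = lin (\<lambda>b. ell (u @ b @ v)) (br x y)"
proof -
  consider "key y < key x" | "key x < key y" | "x = y" using key_eq_iff by fastforce
  then have "swap_rel u x y v"
    by cases (auto intro: swap_rel_descent swap_rel_sym swap_rel_same)
  then show ?thesis unfolding swap_rel_def .
qed

text \<open>The largest left ideal in the kernel of \<open>lin ell\<close>. It contains the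
  generators of \<open>Wker \<phi>\<close> but not 1, so its quotient is a nonzero quotient of
  W(\<phi>).\<close>

definition annihilator :: "tens set" where
  "annihilator = {x. \<forall>a. lin ell (a * x) = 0}"

lemma left_ideal_annihilator: "left_ideal annihilator"
  unfolding left_ideal_def annihilator_def by (auto simp: tmul_eq_times distrib_left simp flip: mult.assoc)

lemma Wgens_subset_annihilator: "Wgens \<phi> \<subseteq> annihilator"
proof -
  have "lin ell (c * (a * (gvec x * gvec y - gvec y * gvec x - br x y) * b)) = 0" for a b c x y
  proof -
    have "lin (\<lambda>u. lin (\<lambda>v. lin (\<lambda>t. ell (u @ v @ t)) b) (gvec x * gvec y - gvec y * gvec x - br x y)) (c * a) = 0"
    proof -
      have "lin (\<lambda>v. lin (\<lambda>t. ell (u @ v @ t)) b) (gvec x * gvec y - gvec y * gvec x - br x y) = 0" for u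
      proof -
        have "lin (\<lambda>v. lin (\<lambda>t. ell (u @ v @ t)) b) (gvec x * gvec y - gvec y * gvec x - br x y)
          = lin (\<lambda>t. ell (u @ x # y # t) - ell (u @ y # x # t)) b - lin (\<lambda>v. lin (\<lambda>t. ell (u @ v @ t)) b) (br x y)"
          by (simp add: gvec_def single_mult_single lin_fun_diff)
        also have "\<dots> = 0"
          unfolding ell_commutator by (subst lin_swap) simp
        finally show ?thesis .
      qed
      then show ?thesis by simp
    qed
    moreover have "c * (a * (gvec x * gvec y - gvec y * gvec x - br x y) * b)
        = (c * a) * ((gvec x * gvec y - gvec y * gvec x - br x y) * b)" by (simp only: mult.assoc)
    ultimately show ?thesis by (simp only: lin_times)
  qed
  moreover have "lin ell (c * (gvec p - tscal (\<phi> p))) = 0" if "in_p p" for c p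
    using ell_snoc_p[OF that] by (simp add: lin_times gvec_def tscal_def)
  ultimately show ?thesis by (auto simp: Wgens_def annihilator_def tmul_eq_times)
qed

lemma special_in_annihilator: "m \<in> T \<Longrightarrow> gvec (D m) - r \<in> annihilator"
  by (simp add: annihilator_def lin_times gvec_def ell_snoc_special)

lemma one_not_in_annihilator: "1 \<notin> annihilator"
proof -
  have "lin ell (1 * 1) \<noteq> 0" by (simp add: one_tens single_mult_single)
  then show ?thesis unfolding annihilator_def by blast
qed

lemma Wker_subset_annihilator: "Wker \<phi> \<subseteq> annihilator"
  unfolding Wker_def using left_ideal_annihilator Wgens_subset_annihilator by blast

end

section \<open>The degree filtration\<close>

lemma left_ideal_times: "left_ideal S \<Longrightarrow> x \<in> S \<Longrightarrow> a * x \<in> S"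
  by (auto simp: left_ideal_def tmul_eq_times)

lemma left_ideal_add: "left_ideal S \<Longrightarrow> x \<in> S \<Longrightarrow> y \<in> S \<Longrightarrow> x + y \<in> S"
  by (auto simp: left_ideal_def)

lemma left_ideal_zero: "left_ideal S \<Longrightarrow> 0 \<in> S"
  by (auto simp: left_ideal_def)

lemma left_ideal_uminus: "left_ideal S \<Longrightarrow> x \<in> S \<Longrightarrow> - x \<in> S"
  using left_ideal_times[of S x "- 1"] by simp

lemma left_ideal_diff: "left_ideal S \<Longrightarrow> x \<in> S \<Longrightarrow> y \<in> S \<Longrightarrow> x - y \<in> S"
  using left_ideal_add[of S x "- y"] left_ideal_uminus[of S y] by simp

lemma left_ideal_sum: "left_ideal S \<Longrightarrow> (\<And>i. i \<in> A \<Longrightarrow> x i \<in> S) \<Longrightarrow> sum x A \<in> S"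
  by (induction A rule: infinite_finite_induct) (auto intro: left_ideal_zero left_ideal_add)

lemma left_ideal_one: "left_ideal S \<Longrightarrow> 1 \<in> S \<Longrightarrow> S = UNIV"
  using left_ideal_times[of S 1] by auto

lemma left_ideal_Wker: "left_ideal (Wker \<phi>)"
  unfolding Wker_def left_ideal_def by auto

lemma Wgens_subset_Wker: "Wgens \<phi> \<subseteq> Wker \<phi>"
  unfolding Wker_def by auto

lemma commutator_in_Wker:
  "(gvec x * gvec y - gvec y * gvec x - br x y) * b \<in> Wker \<phi>"
proof -
  have "tmul (tmul 1 (tmul (gvec x) (gvec y) - tmul (gvec y) (gvec x) - br x y)) b \<in> Wgens \<phi>"
    unfolding Wgens_def by blast
  then show ?thesis using Wgens_subset_Wker by (auto simp: tmul_eq_times)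
qed

lemma p_in_Wker: "in_p p \<Longrightarrow> gvec p - tscal (\<phi> p) \<in> Wker \<phi>"
  by (rule subsetD[OF Wgens_subset_Wker]) (auto simp: Wgens_def)

text \<open>No order is imposed on the letters: words need only span the filtration, not form a
  basis.\<close>

definition dword :: "int list \<Rightarrow> tens" where
  "dword us = single (map D us) 1"

lemma dword_Nil [simp]: "dword [] = 1"
  by (simp add: dword_def one_tens)

lemma dword_Cons: "dword (m # us) = gvec (D m) * dword us"
  by (simp add: dword_def gvec_def single_mult_single)

lemma times_tscal_left_commute: "x * (tscal c * y) = tscal c * (x * y)"
  using tscal_commute[of x c] by (simp add: mult.assoc[symmetric])

lemma gvec_tscal: "gvec g * (tscal c * y) = tscal c * (gvec g * y)"
  by (rule times_tscal_left_commute)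

text \<open>Elements that are of degree strictly below \<open>k\<close> in W(\<phi>): level 0 is
  \<open>Wker \<phi>\<close>, and level 1 adds the scalars.\<close>

inductive_set fil :: "(gen \<Rightarrow> complex) \<Rightarrow> nat \<Rightarrow> tens set" for \<phi> :: "gen \<Rightarrow> complex" and k :: nat where
  ker: "x \<in> Wker \<phi> \<Longrightarrow> x \<in> fil \<phi> k"
| word: "length us < k \<Longrightarrow> dword us \<in> fil \<phi> k"
| add: "x \<in> fil \<phi> k \<Longrightarrow> y \<in> fil \<phi> k \<Longrightarrow> x + y \<in> fil \<phi> k"
| scale: "x \<in> fil \<phi> k \<Longrightarrow> tscal c * x \<in> fil \<phi> k"

lemma fil_mono: "x \<in> fil \<phi> j \<Longrightarrow> j \<le> k \<Longrightarrow> x \<in> fil \<phi> k"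
  by (induction rule: fil.induct) (auto intro: fil.intros)

lemma fil_0: "x \<in> fil \<phi> 0 \<Longrightarrow> x \<in> Wker \<phi>"
  by (induction rule: fil.induct) (auto intro: left_ideal_add left_ideal_times left_ideal_Wker)

lemma fil_uminus: "x \<in> fil \<phi> k \<Longrightarrow> - x \<in> fil \<phi> k"
  using fil.scale[of x \<phi> k "- 1"] by (simp add: tscal_uminus)

lemma fil_diff: "x \<in> fil \<phi> k \<Longrightarrow> y \<in> fil \<phi> k \<Longrightarrow> x - y \<in> fil \<phi> k"
  using fil.add[of x \<phi> k "- y"] fil_uminus[of y \<phi> k] by simp

lemma fil_zero: "0 \<in> fil \<phi> k"
  by (intro fil.ker left_ideal_zero left_ideal_Wker)

lemma fil_sum: "(\<And>i. i \<in> A \<Longrightarrow> x i \<in> fil \<phi> k) \<Longrightarrow> sum x A \<in> fil \<phi> k"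
  by (induction A rule: infinite_finite_induct) (auto intro: fil_zero fil.add)

lemma fil_D: "x \<in> fil \<phi> k \<Longrightarrow> gvec (D m) * x \<in> fil \<phi> (Suc k)"
proof (induction rule: fil.induct)
  case (word us)
  then show ?case using fil.word[of "m # us" "Suc k" \<phi>] by (simp add: dword_Cons)
next
  case (scale x c)
  then show ?case by (simp add: times_tscal_left_commute fil.scale)
qed (auto simp: distrib_left intro: fil.ker fil.add left_ideal_times left_ideal_Wker)

text \<open>Covers \<open>k = 0\<close> as well, where \<open>k - 1\<close> is truncated: level 0 is
  a left ideal.\<close>

lemma fil_D_pred: "x \<in> fil \<phi> (k - 1) \<Longrightarrow> gvec (D m) * x \<in> fil \<phi> k"
proof (cases k)
  case 0
  then show "x \<in> fil \<phi> (k - 1) \<Longrightarrow> ?thesis"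
    by (auto dest!: fil_0 intro: fil.ker left_ideal_times left_ideal_Wker)
next
  case (Suc j)
  then show "x \<in> fil \<phi> (k - 1) \<Longrightarrow> ?thesis" by (simp add: fil_D)
qed

text \<open>A central letter commutes past every \<open>D m\<close> until it meets the generator,
  where it acts by \<phi>.\<close>

lemma fil_central:
  assumes "x \<in> fil \<phi> k" "z = C \<or> z = L"
  shows "(gvec z - tscal (\<phi> z)) * x \<in> Wker \<phi>"
  using assms(1)
proof (induction rule: fil.induct)
  case (ker x)
  then show ?case by (intro left_ideal_times left_ideal_Wker)
next
  case (word us)
  show ?case
  proof (induction us)
    case Nil
    show ?case using p_in_Wker[of z \<phi>] assms(2) by (auto simp: in_p_def)
  next
    case (Cons m us)
    have br0: "br z (D m) = 0" using assms(2) by (auto simp: br.simps)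
    have "(gvec z - tscal (\<phi> z)) * dword (m # us)
        = gvec (D m) * ((gvec z - tscal (\<phi> z)) * dword us)
          + (gvec z * gvec (D m) - gvec (D m) * gvec z - br z (D m)) * dword us"
      by (simp add: dword_Cons br0 algebra_simps gvec_tscal)
    then show ?case
      using left_ideal_add[OF left_ideal_Wker left_ideal_times[OF left_ideal_Wker Cons] commutator_in_Wker]
      by simp
  qed
next
  case (add x y)
  then show ?case by (simp add: distrib_left left_ideal_add[OF left_ideal_Wker])
next
  case (scale x c)
  then show ?case by (simp add: times_tscal_left_commute left_ideal_times[OF left_ideal_Wker])
qed

lemma fil_C: "x \<in> fil \<phi> k \<Longrightarrow> gvec C * x \<in> fil \<phi> k"
proof -
  assume x: "x \<in> fil \<phi> k"
  have "gvec C * x = (gvec C - tscal (\<phi> C)) * x + tscal (\<phi> C) * x" by (simp add: algebra_simps)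
  then show ?thesis using fil.add[OF fil.ker[OF fil_central[OF x]] fil.scale[OF x]] by simp
qed

section \<open>The action of the Heisenberg part on symbols\<close>

abbreviation lower :: "(gen \<Rightarrow> complex) \<Rightarrow> int \<Rightarrow> tens" where
  "lower \<phi> n \<equiv> gvec (H n) - tscal (\<phi> (H n))"

text \<open>Replaces each letter \<open>d\<^sub>m\<close> of the word in turn by the scalar \<open>l m\<close> and sums up: the derivation
  of the symmetric algebra extending \<open>l\<close>, lifted to words.\<close>
fun contract :: "(int \<Rightarrow> complex) \<Rightarrow> int list \<Rightarrow> tens" where
  "contract l [] = 0"
| "contract l (m # us) = tscal (l m) * dword us + gvec (D m) * contract l us"

lemma contract_cong: "(\<And>m. m \<in> set us \<Longrightarrow> l m = l' m) \<Longrightarrow> contract l us = contract l' us"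
  by (induction us) auto

lemma contract_sum:
  "contract (\<lambda>m. \<Sum>n\<in>B. c n * l n m) us = (\<Sum>n\<in>B. tscal (c n) * contract (l n) us)"
  by (induction us)
    (auto simp: tscal_sum tscal_mult sum_distrib_left sum_distrib_right distrib_left sum.distrib
      gvec_tscal mult.assoc)

lemma contract_fil: "contract l us \<in> fil \<phi> (length us)"
  by (induction us) (auto intro!: fil_zero fil.add fil_D fil.scale fil.word)

text \<open>Moving \<open>H n\<close> past \<open>D m\<close> produces a multiple of
  \<open>H (m + n)\<close>, that is, a scalar and a copy of \<open>lower \<phi> (m + n)\<close>. The
  scalars make up \<open>contract\<close>; the second conjunct, for all \<open>n\<close>, bounds the
  other copies.\<close>

lemma lower_dword_aux:
  "lower \<phi> n * dword us - tscal (of_int n + 1/2) * contract (\<lambda>m. \<phi> (H (m + n))) us \<in> fil \<phi> (length us - 1)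
    \<and> lower \<phi> n * dword us \<in> fil \<phi> (length us)"
proof (induction us arbitrary: n)
  case Nil
  have "lower \<phi> n \<in> Wker \<phi>" by (rule p_in_Wker) (simp add: in_p_def)
  then show ?case by (auto intro: fil.ker)
next
  case (Cons m us)
  let ?h = "of_int n + 1/2 :: complex" and ?l = "\<lambda>m. \<phi> (H (m + n))"
  have b: "br (H n) (D m) = tscal ?h * gvec (H (m + n))"
    by (simp add: br.simps tscal_def gvec_def single_mult_single)
  have "lower \<phi> n * dword (m # us) - tscal ?h * contract ?l (m # us)
      = gvec (D m) * (lower \<phi> n * dword us - tscal ?h * contract ?l us)
        + (gvec (H n) * gvec (D m) - gvec (D m) * gvec (H n) - br (H n) (D m)) * dword us
        + tscal ?h * (lower \<phi> (m + n) * dword us)"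
    by (simp add: dword_Cons b algebra_simps gvec_tscal)
  also have "\<dots> \<in> fil \<phi> (length us)"
    using Cons.IH by (intro fil.add fil_D_pred fil.scale fil.ker[OF commutator_in_Wker]) auto
  finally have 1: "lower \<phi> n * dword (m # us) - tscal ?h * contract ?l (m # us) \<in> fil \<phi> (length us)" .
  have "lower \<phi> n * dword (m # us) = (lower \<phi> n * dword (m # us) - tscal ?h * contract ?l (m # us))
      + tscal ?h * contract ?l (m # us)" by simp
  also have "\<dots> \<in> fil \<phi> (length (m # us))"
    by (intro fil.add fil_mono[OF 1] fil.scale contract_fil) simp
  finally show ?case using 1 by simp
qed

lemmas lower_dword = lower_dword_aux[THEN conjunct1] lower_dword_aux[THEN conjunct2]

lemma lower_fil: "x \<in> fil \<phi> k \<Longrightarrow> lower \<phi> n * x \<in> fil \<phi> (k - 1)"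
proof (induction rule: fil.induct)
  case (ker x)
  then show ?case by (intro fil.ker left_ideal_times left_ideal_Wker)
next
  case (word us)
  then show ?case by (intro fil_mono[OF lower_dword(2)]) simp
next
  case (add x y)
  then show ?case by (simp add: distrib_left fil.add)
next
  case (scale x c)
  then show ?case by (simp add: times_tscal_left_commute fil.scale)
qed

text \<open>Only the letters \<open>D m\<close> raise the degree, and each by at most one.\<close>

lemma fil_exhaust: "\<exists>k. x \<in> fil \<phi> k"
proof -
  have g: "\<exists>j. gvec g * x \<in> fil \<phi> j" if "x \<in> fil \<phi> k" for g x k
  proof (cases g)
    case (D m)
    then show ?thesis using fil_D[OF that] by blast
  next
    case (H n)
    have "gvec (gen.H n) * x = lower \<phi> n * x + tscal (\<phi> (gen.H n)) * x" by (simp add: algebra_simps)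
    then show ?thesis
      using fil.add[OF fil_mono[OF lower_fil[OF that], of k] fil.scale[OF that]] H by (intro exI[of _ k]) simp
  next
    case C
    then show ?thesis using fil_C[OF that] by blast
  next
    case L
    have "gvec gen.L * x = (gvec gen.L - tscal (\<phi> gen.L)) * x + tscal (\<phi> gen.L) * x"
      by (simp add: algebra_simps)
    then show ?thesis
      using fil.add[OF fil.ker[OF fil_central[OF that, of gen.L]] fil.scale[OF that]] L by (intro exI[of _ k]) simp
  qed
  have w: "\<exists>k. single w 1 \<in> fil \<phi> k" for w
  proof (induction w)
    case Nil
    show ?case using fil.word[of "[]" 1 \<phi>] by (auto simp: one_tens)
  next
    case (Cons a w)
    then obtain k where "single w 1 \<in> fil \<phi> k" by blast
    from g[OF this, of a] show ?case by (simp add: gvec_def single_mult_single)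
  qed
  have "\<exists>k. sum (\<lambda>w. single w (lookup x w)) A \<in> fil \<phi> k" for A
  proof (induction A rule: infinite_finite_induct)
    case (insert a A)
    obtain k where k: "sum (\<lambda>w. single w (lookup x w)) A \<in> fil \<phi> k" using insert by blast
    obtain j where j: "single a 1 \<in> fil \<phi> j" using w by blast
    have "tscal (lookup x a) * single a 1 + sum (\<lambda>w. single w (lookup x w)) A \<in> fil \<phi> (max j k)"
      by (intro fil.add fil.scale fil_mono[OF j] fil_mono[OF k]) auto
    then show ?case using insert.hyps by (auto simp: tscal_times_single)
  qed (auto intro: fil_zero)
  from this[of "keys x"] show ?thesis by (simp flip: poly_mapping_sum_single)
qed

section \<open>Euler's operator modulo lower degree\<close>

lemma fil_D_commute:
  assumes "x \<in> fil \<phi> k"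
  shows "gvec (D m) * (gvec (D n) * x) - gvec (D n) * (gvec (D m) * x) \<in> fil \<phi> (Suc k)"
proof -
  have "gvec (D m) * (gvec (D n) * x) - gvec (D n) * (gvec (D m) * x)
      = (gvec (D m) * gvec (D n) - gvec (D n) * gvec (D m) - br (D m) (D n)) * x + br (D m) (D n) * x"
    by (simp add: algebra_simps)
  \<comment> \<open>The bracket offers one letter \<open>D\<close> or a central one in place of two
    letters \<open>D\<close>, so reordering costs a term of lower degree only.\<close>
  moreover have "br (D m) (D n) * x \<in> fil \<phi> (Suc k)"
  proof -
    have "br (D m) (D n) = tscal (of_int (m - n)) * gvec (D (m + n))
        + tscal (if m + n = 0 then of_int (m ^ 3 - m) / 12 else 0) * gvec C"
      by (simp add: br.simps gvec_def tscal_times_single)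
    then have "br (D m) (D n) * x = tscal (of_int (m - n)) * (gvec (D (m + n)) * x)
        + tscal (if m + n = 0 then of_int (m ^ 3 - m) / 12 else 0) * (gvec C * x)"
      by (simp only: distrib_right mult.assoc)
    also have "\<dots> \<in> fil \<phi> (Suc k)"
      by (intro fil.add fil.scale fil_D assms fil_mono[OF fil_C[OF assms]]) simp
    finally show ?thesis .
  qed
  ultimately show ?thesis using fil.add[OF fil.ker[OF commutator_in_Wker]] by metis
qed

text \<open>Euler's identity for homogeneous polynomials, modulo lower order terms.\<close>
lemma euler_dword:
  assumes "finite J" "set us \<subseteq> J"
  shows "(\<Sum>m\<in>J. gvec (D m) * contract (\<lambda>i. if i = m then 1 else 0) us) - tscal (of_nat (length us)) * dword us
    \<in> fil \<phi> (length us)"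
  using assms(2)
proof (induction us)
  case Nil
  then show ?case by (simp add: fil_zero)
next
  case (Cons j us)
  let ?c = "\<lambda>m. contract (\<lambda>i. if i = m then 1 else 0)"
  have j: "j \<in> J" using Cons by simp
  \<comment> \<open>Contracting the first letter contributes only for \<open>m = j\<close>, where it
    restores the word and adds one to the eigenvalue. In the other terms \<open>D m\<close> is moved
    past \<open>D j\<close>.\<close>
  have "(\<Sum>m\<in>J. gvec (D m) * (tscal (if j = m then 1 else 0) * dword us)) = gvec (D j) * dword us"
    using j assms(1) by (subst sum.remove[OF assms(1) j]) (simp add: sum.neutral)
  then have "(\<Sum>m\<in>J. gvec (D m) * ?c m (j # us)) - tscal (of_nat (length (j # us))) * dword (j # us)
      = gvec (D j) * ((\<Sum>m\<in>J. gvec (D m) * ?c m us) - tscal (of_nat (length us)) * dword us)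
        + (\<Sum>m\<in>J. gvec (D m) * (gvec (D j) * ?c m us) - gvec (D j) * (gvec (D m) * ?c m us))"
    by (simp add: sum.distrib sum_subtractf sum_distrib_left distrib_left right_diff_distrib dword_Cons
        tscal_add distrib_right gvec_tscal)
  also have "\<dots> \<in> fil \<phi> (Suc (length us))"
    using Cons by (intro fil.add fil_D fil_sum fil_D_commute contract_fil) auto
  finally show ?case by simp
qed

text \<open>\<open>b m\<close> holds the coefficients of a combination of the operators
  \<open>lower \<phi> n\<close> that acts on symbols in the letters of \<open>J\<close> as the
  partial derivative with respect to \<open>D m\<close>.\<close>

definition dual_family :: "(gen \<Rightarrow> complex) \<Rightarrow> int set \<Rightarrow> (int \<Rightarrow> int \<Rightarrow>\<^sub>0 complex) \<Rightarrow> bool" where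
  "dual_family \<phi> J b \<longleftrightarrow>
     (\<forall>m\<in>J. \<forall>i\<in>J. lin (\<lambda>n. (of_int n + 1/2) * \<phi> (H (i + n))) (b m) = (if i = m then 1 else 0))"

definition lower_comb :: "(gen \<Rightarrow> complex) \<Rightarrow> (int \<Rightarrow>\<^sub>0 complex) \<Rightarrow> tens" where
  "lower_comb \<phi> b = (\<Sum>n\<in>keys b. tscal (lookup b n) * lower \<phi> n)"

lemma lower_comb_fil: "x \<in> fil \<phi> k \<Longrightarrow> lower_comb \<phi> b * x \<in> fil \<phi> (k - 1)"
  unfolding lower_comb_def sum_distrib_right mult.assoc by (intro fil_sum fil.scale lower_fil)

lemma lower_comb_dword:
  assumes b: "dual_family \<phi> J b" and m: "m \<in> J" and us: "set us \<subseteq> J"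
  shows "lower_comb \<phi> (b m) * dword us - contract (\<lambda>i. if i = m then 1 else 0) us \<in> fil \<phi> (length us - 1)"
proof -
  let ?l = "\<lambda>n i. (of_int n + 1/2) * \<phi> (H (i + n))"
  have comb: "(\<Sum>n\<in>B. t n * a n) * w - (\<Sum>n\<in>B. t n * s n) = (\<Sum>n\<in>B. t n * (a n * w - s n))"
    for B :: "int set" and t a s and w :: tens
    by (simp add: sum_distrib_right mult.assoc right_diff_distrib sum_subtractf)
  have "contract (\<lambda>i. if i = m then 1 else 0) us = contract (\<lambda>i. \<Sum>n\<in>keys (b m). lookup (b m) n * ?l n i) us"
    using b m us by (intro contract_cong) (auto simp: dual_family_def lin_def)
  also have "\<dots> = (\<Sum>n\<in>keys (b m). tscal (lookup (b m) n) * contract (?l n) us)"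
    by (rule contract_sum)
  also have "\<dots> = (\<Sum>n\<in>keys (b m). tscal (lookup (b m) n) * (tscal (of_int n + 1/2) * contract (\<lambda>i. \<phi> (H (i + n))) us))"
  proof (rule sum.cong[OF refl])
    fix n
    show "tscal (lookup (b m) n) * contract (?l n) us
      = tscal (lookup (b m) n) * (tscal (of_int n + 1/2) * contract (\<lambda>i. \<phi> (H (i + n))) us)"
      using contract_sum[of "\<lambda>_. of_int n + 1/2" "\<lambda>_ i. \<phi> (H (i + n))" "{()}" us] by simp
  qed
  finally have "lower_comb \<phi> (b m) * dword us - contract (\<lambda>i. if i = m then 1 else 0) us
      = (\<Sum>n\<in>keys (b m). tscal (lookup (b m) n) *
          (lower \<phi> n * dword us - tscal (of_int n + 1/2) * contract (\<lambda>i. \<phi> (H (i + n))) us))"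
    unfolding lower_comb_def by (simp only: comb)
  then show ?thesis by (simp only:) (intro fil_sum fil.scale lower_dword)
qed

text \<open>Euler's operator realised by an element of the tensor algebra, so every left ideal is
  stable under it.\<close>

definition omega :: "(gen \<Rightarrow> complex) \<Rightarrow> int set \<Rightarrow> (int \<Rightarrow> int \<Rightarrow>\<^sub>0 complex) \<Rightarrow> tens" where
  "omega \<phi> J b = (\<Sum>m\<in>J. gvec (D m) * lower_comb \<phi> (b m))"

lemma omega_fil: "x \<in> fil \<phi> k \<Longrightarrow> omega \<phi> J b * x \<in> fil \<phi> k"
  unfolding omega_def sum_distrib_right mult.assoc by (intro fil_sum fil_D_pred lower_comb_fil)

lemma omega_dword:
  assumes "finite J" "dual_family \<phi> J b" "set us \<subseteq> J"
  shows "omega \<phi> J b * dword us - tscal (of_nat (length us)) * dword us \<in> fil \<phi> (length us)"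
proof -
  let ?c = "\<lambda>m. contract (\<lambda>i. if i = m then 1 else 0)"
  have "omega \<phi> J b * dword us - tscal (of_nat (length us)) * dword us
      = (\<Sum>m\<in>J. gvec (D m) * (lower_comb \<phi> (b m) * dword us - ?c m us))
        + ((\<Sum>m\<in>J. gvec (D m) * ?c m us) - tscal (of_nat (length us)) * dword us)"
    by (simp add: omega_def sum_distrib_right mult.assoc right_diff_distrib sum_subtractf)
  also have "\<dots> \<in> fil \<phi> (length us)"
    using assms by (intro fil.add fil_sum fil_D_pred lower_comb_dword euler_dword)
  finally show ?thesis .
qed

text \<open>\<open>J0\<close> collects the letters of the words of degree \<open>k\<close> in
  \<open>x\<close>. Admitting every larger \<open>J\<close> lets the sets for two summands be
  merged.\<close>

lemma omega_eigen:
  assumes "x \<in> fil \<phi> (Suc k)"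
  shows "\<exists>J0. finite J0 \<and> (\<forall>J b. finite J \<and> J0 \<subseteq> J \<and> dual_family \<phi> J b \<longrightarrow>
    omega \<phi> J b * x - tscal (of_nat k) * x \<in> fil \<phi> k)"
  using assms
proof (induction rule: fil.induct)
  case (ker x)
  then show ?case
    by (intro exI[of _ "{}"]) (auto intro: fil.ker left_ideal_diff left_ideal_times left_ideal_Wker)
next
  case (word us)
  show ?case
  proof (cases "length us = k")
    case True
    then show ?thesis using omega_dword[of _ \<phi> _ us] by (intro exI[of _ "set us"]) auto
  next
    case False
    then have "dword us \<in> fil \<phi> k" using word by (intro fil.word) simp
    then show ?thesis by (intro exI[of _ "{}"]) (auto intro: fil_diff omega_fil fil.scale)
  qed
next
  case (add x y)
  obtain J1 where 1: "finite J1" "\<And>J b. finite J \<and> J1 \<subseteq> J \<and> dual_family \<phi> J b \<Longrightarrow>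
      omega \<phi> J b * x - tscal (of_nat k) * x \<in> fil \<phi> k"
    using add.IH(1) by blast
  obtain J2 where 2: "finite J2" "\<And>J b. finite J \<and> J2 \<subseteq> J \<and> dual_family \<phi> J b \<Longrightarrow>
      omega \<phi> J b * y - tscal (of_nat k) * y \<in> fil \<phi> k"
    using add.IH(2) by blast
  have e: "omega \<phi> J b * (x + y) - tscal (of_nat k) * (x + y)
      = (omega \<phi> J b * x - tscal (of_nat k) * x) + (omega \<phi> J b * y - tscal (of_nat k) * y)" for J b
    by (simp add: algebra_simps)
  show ?case unfolding e
  proof (intro exI[of _ "J1 \<union> J2"] conjI allI impI)
    show "finite (J1 \<union> J2)" using 1 2 by simp
    fix J b assume "finite J \<and> J1 \<union> J2 \<subseteq> J \<and> dual_family \<phi> J b"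
    then show "(omega \<phi> J b * x - tscal (of_nat k) * x) + (omega \<phi> J b * y - tscal (of_nat k) * y) \<in> fil \<phi> k"
      by (intro fil.add 1(2) 2(2)) auto
  qed
next
  case (scale x c)
  have e: "omega \<phi> J b * (tscal c * x) - tscal (of_nat k) * (tscal c * x)
      = tscal c * (omega \<phi> J b * x - tscal (of_nat k) * x)" for J b
    by (simp only: right_diff_distrib times_tscal_left_commute[of "omega \<phi> J b" c x]
        times_tscal_left_commute[of "tscal (of_nat k)" c x])
  show ?case unfolding e using scale.IH by (meson fil.scale)
qed

lemma fil_1: "x \<in> fil \<phi> 1 \<Longrightarrow> \<exists>c. x - tscal c \<in> Wker \<phi>"
proof (induction rule: fil.induct)
  case (ker x)
  then show ?case by (intro exI[of _ 0]) simp
next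
  case (word us)
  then show ?case by (intro exI[of _ 1]) (simp add: left_ideal_zero[OF left_ideal_Wker])
next
  case (add x y)
  then obtain c d where "x - tscal c \<in> Wker \<phi>" "y - tscal d \<in> Wker \<phi>" by blast
  from left_ideal_add[OF left_ideal_Wker this] show ?case
    by (intro exI[of _ "c + d"]) (simp add: tscal_add algebra_simps)
next
  case (scale x c)
  then obtain d where "x - tscal d \<in> Wker \<phi>" by blast
  from left_ideal_times[OF left_ideal_Wker this, of "tscal c"] show ?case
    by (intro exI[of _ "c * d"]) (simp add: tscal_mult algebra_simps)
qed

text \<open>Induction on the degree. If some \<open>lower \<phi> n\<close> does not kill
  \<open>x\<close> in W(\<phi>), its image has smaller degree and lies in \<open>S\<close>.
  Otherwise Euler's operator kills \<open>x\<close>, so \<open>x\<close> has degree 0: a scalar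
  modulo \<open>Wker \<phi>\<close>, which is zero or yields 1.\<close>

lemma dual_family_imp_maximal:
  assumes dual: "\<And>J. finite J \<Longrightarrow> \<exists>b. dual_family \<phi> J b"
    and S: "left_ideal S" "Wker \<phi> \<subseteq> S" and x: "x \<in> S" "x \<in> fil \<phi> k"
  shows "x \<in> Wker \<phi> \<or> 1 \<in> S"
  using x
proof (induction k arbitrary: x)
  case 0
  then show ?case by (auto dest: fil_0)
next
  case (Suc k)
  show ?case
  proof (cases "\<forall>n. lower \<phi> n * x \<in> Wker \<phi>")
    case False
    then obtain n where n: "lower \<phi> n * x \<notin> Wker \<phi>" by blast
    have "lower \<phi> n * x \<in> S" by (rule left_ideal_times[OF S(1) Suc.prems(1)])
    moreover have "lower \<phi> n * x \<in> fil \<phi> k" using lower_fil[OF Suc.prems(2)] by simp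
    ultimately show ?thesis using Suc.IH n by blast
  next
    case True
    obtain J0 where J0: "finite J0" "\<And>b. dual_family \<phi> J0 b \<Longrightarrow>
        omega \<phi> J0 b * x - tscal (of_nat k) * x \<in> fil \<phi> k"
      using omega_eigen[OF Suc.prems(2)] by blast
    obtain b where b: "dual_family \<phi> J0 b" using dual J0(1) by blast
    have "lower_comb \<phi> (b m) * x \<in> Wker \<phi>" for m
      unfolding lower_comb_def sum_distrib_right mult.assoc
      using True by (intro left_ideal_sum[OF left_ideal_Wker] left_ideal_times[OF left_ideal_Wker, of "lower \<phi> _ * x"]) blast
    then have "omega \<phi> J0 b * x \<in> Wker \<phi>"
      unfolding omega_def sum_distrib_right mult.assoc
      by (intro left_ideal_sum[OF left_ideal_Wker] left_ideal_times[OF left_ideal_Wker, of "lower_comb \<phi> _ * x"])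
    \<comment> \<open>\<open>omega\<close> kills \<open>x\<close> but multiplies its symbol of
      degree \<open>k\<close> by \<open>k\<close>; hence \<open>k\<close> times \<open>x\<close> has
      smaller degree.\<close>
    then have "omega \<phi> J0 b * x - (omega \<phi> J0 b * x - tscal (of_nat k) * x) \<in> fil \<phi> k"
      by (rule fil_diff[OF fil.ker J0(2)[OF b]])
    then have kx: "tscal (of_nat k) * x \<in> fil \<phi> k" by simp
    show ?thesis
    proof (cases "k = 0")
      case False
      have "tscal (1 / of_nat k) * (tscal (of_nat k) * x) = tscal (1 / of_nat k * of_nat k) * x"
        by (simp only: tscal_mult mult.assoc)
      then have "x \<in> fil \<phi> k" using fil.scale[OF kx, of "1 / of_nat k"] False by simp
      then show ?thesis using Suc by blast
    next
      case True
      then obtain c where c: "x - tscal c \<in> Wker \<phi>" using fil_1[of x \<phi>] Suc.prems by auto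
      show ?thesis
      proof (cases "c = 0")
        case True
        then show ?thesis using c by simp
      next
        case False
        have "x - (x - tscal c) \<in> S" by (rule left_ideal_diff[OF S(1) Suc.prems(1) subsetD[OF S(2) c]])
        then have "tscal (1 / c) * tscal c \<in> S" using left_ideal_times[OF S(1)] by simp
        then show ?thesis using False by (simp flip: tscal_mult)
      qed
    qed
  qed
qed

section \<open>Dual bases of linearly independent functions\<close>

lemma lin_dual_basis:
  fixes f :: "'i \<Rightarrow> 'n \<Rightarrow> complex"
  assumes "finite J" and "\<And>c. (\<And>n. (\<Sum>m\<in>J. c m * f m n) = 0) \<Longrightarrow> (\<forall>m\<in>J. c m = 0)"
  shows "\<exists>b. \<forall>m\<in>J. \<forall>i\<in>J. lin (f i) (b m) = (if i = m then 1 else 0)"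
  using assms
proof (induction J rule: finite_induct)
  case empty
  then show ?case by simp
next
  case (insert j J)
  define scl where "scl c a = (\<Sum>n\<in>keys a. single n (c * lookup a n))" for c and a :: "'n \<Rightarrow>\<^sub>0 complex"
  have scl: "lin g (scl c a) = c * lin g a" for g c a
    by (simp add: scl_def lin_sum) (simp add: lin_def sum_distrib_left mult.assoc)
  have "\<forall>m\<in>J. c m = 0" if c: "\<And>n. (\<Sum>m\<in>J. c m * f m n) = 0" for c
  proof -
    have "(\<Sum>m\<in>insert j J. (if m = j then 0 else c m) * f m n) = (\<Sum>m\<in>J. c m * f m n)" for n
      using insert.hyps by (auto intro!: sum.cong)
    then have *: "\<forall>m\<in>insert j J. (if m = j then 0 else c m) = 0" using c by (intro insert.prems) simp
    show ?thesis
    proof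
      fix m assume "m \<in> J"
      then have "(if m = j then 0 else c m) = 0" "m \<noteq> j" using * insert.hyps by blast+
      then show "c m = 0" by simp
    qed
  qed
  then obtain b where b: "\<And>m i. m \<in> J \<Longrightarrow> i \<in> J \<Longrightarrow> lin (f i) (b m) = (if i = m then 1 else 0)"
    using insert.IH by blast
  \<comment> \<open>Subtracting the combination with coefficients \<beta> from \<open>f j\<close>
    leaves a function that vanishes on every \<open>b m\<close>; by independence it is nonzero at
    some point \<open>n\<close>.\<close>
  define \<beta> where "\<beta> m = lin (f j) (b m)" for m
  have "\<exists>n. f j n - (\<Sum>m\<in>J. \<beta> m * f m n) \<noteq> 0"
  proof (rule ccontr)
    assume "\<not> ?thesis"
    then have z: "f j n - (\<Sum>m\<in>J. \<beta> m * f m n) = 0" for n by blast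
    have "(\<Sum>m\<in>insert j J. (if m = j then 1 else - \<beta> m) * f m n) = f j n - (\<Sum>m\<in>J. \<beta> m * f m n)" for n
    proof -
      have "(\<Sum>m\<in>J. (if m = j then 1 else - \<beta> m) * f m n) = (\<Sum>m\<in>J. - (\<beta> m * f m n))"
        using insert.hyps by (intro sum.cong) auto
      then show ?thesis using insert.hyps by (simp add: sum_negf)
    qed
    then have "\<forall>m\<in>insert j J. (if m = j then 1 else - \<beta> m) = 0" using z by (intro insert.prems) simp
    then show False by simp
  qed
  then obtain n where n: "f j n - (\<Sum>m\<in>J. \<beta> m * f m n) \<noteq> 0" by blast
  define \<gamma> where "\<gamma> = f j n - (\<Sum>m\<in>J. \<beta> m * f m n)"
  \<comment> \<open>Evaluation at \<open>n\<close>, corrected to vanish on the earlier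
    \<open>f i\<close> and scaled to give 1 on \<open>f j\<close>.\<close>
  define bj where "bj = scl (1 / \<gamma>) (single n 1 - (\<Sum>m\<in>J. scl (f m n) (b m)))"
  have bj: "lin g bj = (g n - (\<Sum>m\<in>J. f m n * lin g (b m))) / \<gamma>" for g
    by (simp add: bj_def scl lin_sum)
  have bjj: "lin (f j) bj = 1" using n by (simp add: bj \<gamma>_def \<beta>_def mult.commute)
  have bji: "lin (f i) bj = 0" if "i \<in> J" for i
  proof -
    have "(\<Sum>m\<in>J. f m n * lin (f i) (b m)) = (\<Sum>m\<in>J. if m = i then f i n else 0)"
      using that by (intro sum.cong) (auto simp: b)
    then show ?thesis using that insert.hyps by (simp add: bj)
  qed
  \<comment> \<open>The old dual vectors lose their value on \<open>f j\<close>; since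
    \<open>bj\<close> vanishes on the earlier functions, nothing else changes.\<close>
  define b' where "b' m = (if m = j then bj else b m - scl (\<beta> m) bj)" for m
  have "\<forall>m\<in>insert j J. \<forall>i\<in>insert j J. lin (f i) (b' m) = (if i = m then 1 else 0)"
    using insert.hyps by (auto simp: b'_def scl bjj bji b \<beta>_def)
  then show ?case by blast
qed

text \<open>A linear relation between finitely many shifts of the sequence is a recurrence; the
  factor \<open>n + 1/2\<close> is never zero and cancels.\<close>

lemma not_recurrent_imp_dual_family:
  assumes nr: "\<not> recurrent (\<lambda>n. \<phi> (H n))" and J: "finite J"
  shows "\<exists>b. dual_family \<phi> J b"
  unfolding dual_family_def
proof (rule lin_dual_basis[OF J])
  fix c :: "int \<Rightarrow> complex"
  assume c: "\<And>n. (\<Sum>m\<in>J. c m * ((of_int n + 1/2) * \<phi> (H (m + n)))) = 0"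
  have c': "(\<Sum>m\<in>J. c m * \<phi> (H (m + n))) = 0" for n
  proof -
    have "of_int n + 1/2 \<noteq> (0 :: complex)"
    proof
      assume "of_int n + 1/2 = (0 :: complex)"
      then have "of_int (2 * n + 1) = (0 :: complex)" by (simp add: field_simps)
      then have "2 * n + 1 = 0" by (simp only: of_int_eq_0_iff)
      then show False by presburger
    qed
    moreover have "(of_int n + 1/2) * (\<Sum>m\<in>J. c m * \<phi> (H (m + n))) = 0"
      using c[of n] by (simp only: sum_distrib_left mult.left_commute)
    ultimately show ?thesis by simp
  qed
  show "\<forall>m\<in>J. c m = 0"
  proof (rule ccontr)
    assume "\<not> ?thesis"
    then obtain i where i: "i \<in> J" "c i \<noteq> 0" by blast
    \<comment> \<open>Shifting by the least index turns the integer offsets into exponents of a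
      polynomial.\<close>
    define m0 where "m0 = Min J"
    have m0: "m0 \<le> m" if "m \<in> J" for m using that J by (simp add: m0_def)
    define p where "p = (\<Sum>m\<in>J. monom (c m) (nat (m - m0)))"
    have "coeff p (nat (i - m0)) = (\<Sum>m\<in>J. if m = i then c i else 0)"
      unfolding p_def coeff_sum coeff_monom
      using i m0 by (intro sum.cong) (auto simp: nat_eq_iff)
    then have "p \<noteq> 0" using i J by auto
    moreover have "act p (\<lambda>n. \<phi> (H n)) n = 0" for n
    proof -
      have "act p (\<lambda>n. \<phi> (H n)) n = (\<Sum>m\<in>J. c m * \<phi> (H (m + (n - m0))))"
        unfolding p_def act_sum act_monom using m0 by (intro sum.cong) (auto simp: algebra_simps)
      then show ?thesis using c'[of "n - m0"] by simp
    qed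
    ultimately show False using nr unfolding recurrent_def by blast
  qed
qed

section \<open>Nonvanishing of W(\<phi>) and the two directions\<close>

lemma Wker_ne_UNIV:
  assumes "\<phi> L = 0" shows "Wker \<phi> \<noteq> UNIV"
proof -
  \<comment> \<open>With no special letter the functional lives on W(\<phi>) itself.\<close>
  interpret whittaker_rewriting \<phi> "{}" 0
    by unfold_locales (use assms in auto)
  show ?thesis using Wker_subset_annihilator one_not_in_annihilator by auto
qed

text \<open>Were W(\<phi>) irreducible, \<open>Wker \<phi>\<close> would equal the annihilator for
  every choice of the value \<open>l\<close> on the extra element, hence contain that element minus
  \<open>l\<close> for both \<open>l = 0\<close> and \<open>l = 1\<close>.\<close>

lemma recurrent_imp_reducible:
  assumes "\<phi> L = 0" and "recurrent (\<lambda>n. \<phi> (H n))"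
  shows "\<not> W_irreducible \<phi>"
proof
  assume irr: "W_irreducible \<phi>"
  obtain p where p: "p \<noteq> 0" "\<And>n. act p (\<lambda>n. \<phi> (H n)) n = 0"
    using assms(2) unfolding recurrent_def by blast
  define d where "d = degree p"
  \<comment> \<open>The recurrence made monic: \<open>D (int d)\<close> plus \<open>q\<close> is the
    element to which \<phi> extends as a character.\<close>
  define q where "q = (\<Sum>i<d. single [D (int i)] (coeff p i / coeff p d))"
  have lead: "coeff p d \<noteq> 0" using p by (simp add: d_def)
  have q_keys: "\<exists>m. t = [D m] \<and> m \<noteq> int d" if "t \<in> keys q" for t
  proof -
    have "(\<Sum>i<d. lookup (single [D (int i)] (coeff p i / coeff p d)) t) \<noteq> 0"
      using that by (simp add: in_keys_iff q_def lookup_sum)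
    then obtain i where "i \<in> {..<d}" "lookup (single [D (int i)] (coeff p i / coeff p d)) t \<noteq> 0"
      by (rule sum.not_neutral_contains_not_neutral)
    then have "t = [D (int i)]" "int i \<noteq> int d" by (auto simp: lookup_single when_def split: if_splits)
    then show ?thesis by blast
  qed
  have "gvec (D (int d)) + q - tscal l \<in> Wker \<phi>" for l
  proof -
    \<comment> \<open>Rewriting the top letter to \<open>tscal l - q\<close> imposes the value
      \<open>l\<close> on that element; the recurrence is the compatibility condition.\<close>
    interpret whittaker_rewriting \<phi> "{int d}" "tscal l - q"
    proof unfold_locales
      fix t assume "t \<in> keys (tscal l - q)"
      then have "t = [] \<or> t \<in> keys q"
        by (auto simp: in_keys_iff lookup_minus tscal_def lookup_single when_def)
      then show "t = [] \<or> (\<exists>m. t = [D m] \<and> m \<notin> {int d})" using q_keys by auto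
    next
      fix m n assume m: "m \<in> {int d}"
      let ?f = "\<lambda>t. case t of [D k] \<Rightarrow> \<phi> (H (k + n)) | _ \<Rightarrow> 0"
      have "0 = (\<Sum>i\<le>d. coeff p i * \<phi> (H (n + int i)))"
        using p(2)[of n] unfolding act_conv_sum d_def by simp
      also have "\<dots> = (\<Sum>i<d. coeff p i * \<phi> (H (n + int i))) + coeff p d * \<phi> (H (n + int d))"
        by (simp flip: lessThan_Suc_atMost)
      finally have e: "coeff p d * \<phi> (H (n + int d)) = - (\<Sum>i<d. coeff p i * \<phi> (H (n + int i)))"
        by (simp add: eq_neg_iff_add_eq_0 add.commute)
      have "lin ?f q = (\<Sum>i<d. coeff p i * \<phi> (H (n + int i))) / coeff p d"
        by (simp add: q_def lin_sum sum_divide_distrib add.commute)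
      then have "lin ?f (tscal l - q) = - (\<Sum>i<d. coeff p i * \<phi> (H (n + int i))) / coeff p d"
        by (simp add: tscal_def)
      also have "\<dots> = \<phi> (H (m + n))" using m lead unfolding e[symmetric] by (simp add: add.commute)
      finally show "lin ?f (tscal l - q) = \<phi> (H (m + n))" .
    qed (use assms in auto)
    have "Wker \<phi> = annihilator"
      using irr left_ideal_annihilator Wker_subset_annihilator one_not_in_annihilator
      unfolding W_irreducible_def by blast
    then show ?thesis using special_in_annihilator[of "int d"] by (simp add: algebra_simps)
  qed
  \<comment> \<open>The two instances differ by exactly 1.\<close>
  from left_ideal_diff[OF left_ideal_Wker this[of 0] this[of 1]] have "1 \<in> Wker \<phi>" by simp
  then show False using left_ideal_one[OF left_ideal_Wker] irr unfolding W_irreducible_def by blast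
qed

theorem theorem4p3:
  fixes \<phi> :: "gen \<Rightarrow> complex"
  assumes hom: "\<phi> L = 0"
    and nonzero: "\<exists>n. \<phi> (H n) \<noteq> 0"
  shows "W_irreducible \<phi> \<longleftrightarrow> \<not> exp_polynomial \<phi>"
proof -
  have ep: "exp_polynomial \<phi> \<longleftrightarrow> recurrent (\<lambda>n. \<phi> (H n))"
  proof -
    have "exp_polynomial \<phi> \<longleftrightarrow> exp_poly (\<lambda>n. \<phi> (H n))"
      unfolding exp_polynomial_def exp_poly_def ..
    then show ?thesis using exp_poly_imp_recurrent recurrent_imp_exp_poly by metis
  qed
  have "W_irreducible \<phi>" if "\<not> recurrent (\<lambda>n. \<phi> (H n))"
    unfolding W_irreducible_def
  proof (intro conjI allI impI)
    show "Wker \<phi> \<noteq> UNIV" using Wker_ne_UNIV hom .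
    fix S assume S: "left_ideal S \<and> Wker \<phi> \<subseteq> S"
    show "S = Wker \<phi> \<or> S = UNIV"
    proof (cases "S \<subseteq> Wker \<phi>")
      case False
      then obtain x where x: "x \<in> S" "x \<notin> Wker \<phi>" by blast
      obtain k where "x \<in> fil \<phi> k" using fil_exhaust by blast
      then have "1 \<in> S"
        using dual_family_imp_maximal[OF not_recurrent_imp_dual_family[OF that]] S x by blast
      then show ?thesis using S left_ideal_one by blast
    qed (use S in auto)
  qed
  then show ?thesis using recurrent_imp_reducible[of \<phi>, OF hom] unfolding ep by blast
qed

end
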